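(* For integers $m\ge 1$ and $k\ge 0$ put $$\mathcal{C}_k^m=\int_{0}^{1}x^k \left\{\frac{1}{x}\right\}^m dx.$$ Then, for every $m\ge 1$, $$\mathcal{C}_k^m=\frac{1}{k+1-m}-\frac{1}{(k+1)\binom{k}{m}}\sum_{j=k-m+1}^{k}\binom{j}{k-m}\zeta(j+1)\qquad\text{for } k\ge m,$$ $$\mathcal{C}_{m-1}^m=H_m-\gamma-\sum_{j=1}^{m-1}\frac{\zeta(j+1)}{j+1},$$ and $$\mathcal{C}_k^m=\frac{1}{k+1-m}-\frac{1}{k+1}\binom{m}{k}\left(\sum_{j=1}^{k}\frac{\zeta(j+1)}{\binom{m-k+j}{j}}+\gamma\right)+\binom{m}{k+1}\sum_{j=0}^{m-k-2}\binom{m-k-1}{j}a_j\qquad\text{for } 0\le k\le m-2.$$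
   Context: $\{t\}=t-\lfloor t\rfloor$ denotes the fractional part of the real number $t$. $\gamma$ is the Euler--Mascheroni constant, $H_m=\sum_{i=1}^m \frac1i$ the $m$-th harmonic number, $\zeta$ the Riemann zeta function, $\zeta'$ its derivative, and $B_n$ the Bernoulli numbers, $\frac{t}{e^t-1}=\sum_{n\ge0}B_n\frac{t^n}{n!}$. The sequence $a_n$ ($n\ge 0$) is defined by $$a_{n}=\begin{cases}-\zeta'(-n),& n=0,2,4,\dots,\\ \frac{B_{n+1}}{n+1}\left(\frac{\zeta'(n+1)}{\zeta(n+1)}-\log(2\pi)-\gamma\right), & n=1,3,5,\dots.\end{cases}$$ An empty sum is zero. *)

theory Defs
  imports "HOL-Analysis.Analysis"
begin

(* Analytic continuation of the Dirichlet series. It is unique on the punctured plane, so only the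
   value at the pole 1 depends on the choice operator. *)
definition riemann_zeta :: "complex \<Rightarrow> complex" where
  "riemann_zeta = (SOME f. f holomorphic_on (- {1}) \<and>
     (\<forall>s. Re s > 1 \<longrightarrow> (\<lambda>n. 1 / of_nat (Suc n) powr s) sums f s))"

(* The power series of exp t - 1 has no constant term; fps division cancels the common factor t. *)
definition bernoulli :: "nat \<Rightarrow> real" where
  "bernoulli n = fact n * fps_nth (fps_X / (fps_exp 1 - 1)) n"

definition frac_integral :: "nat \<Rightarrow> nat \<Rightarrow> real" where
  "frac_integral k m = integral {0..1} (\<lambda>x. x ^ k * frac (1 / x) ^ m)"

(* Complex-valued because riemann_zeta is; every term is in fact real. *)
definition a_seq :: "nat \<Rightarrow> complex" where
  "a_seq n =
     (if even n then - deriv riemann_zeta (- of_nat n)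
      else of_real (bernoulli (n + 1)) / of_nat (n + 1) *
        (deriv riemann_zeta (of_nat (n + 1)) / riemann_zeta (of_nat (n + 1))
           - of_real (ln (2 * pi)) - euler_mascheroni))"

end

theory Submission
  imports Defs "HOL-Complex_Analysis.Complex_Analysis"
begin

text \<open>
  The substitution \<open>u = 1 / x\<close> turns the integral into the value at \<open>s = k + 1\<close> of the Mellin transform
  \[ F_r(s) = \int_1^\infty \{u\}^r u^{-s-1} du = \sum_{n \ge 1} \int_0^1 t^r (n + t)^{-s-1} dt \]
  with \<open>r = m\<close> (lemma \<open>frac_integral_eq_frac_mellin\<close>), which is holomorphic for \<open>Re s > 0\<close>. Integration by parts gives
  \<open>s F_r(s) = 1 - \<zeta>(s) + r F_{r-1}(s - 1)\<close> for \<open>Re s > 1\<close>, and \<open>F_0(s) = 1 / s\<close>. Iterating expresses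
  \<open>F_r(s)\<close> through \<open>\<zeta>(s), \<zeta>(s - 1), \<dots>, \<zeta>(s - r + 1)\<close>, at first for \<open>Re s > r\<close>; since both sides continue
  analytically, the identity holds on all of \<open>Re s > 0\<close> away from the poles of its right-hand side
  (lemma \<open>frac_mellin_expansion\<close>).

  For \<open>k \<ge> m\<close> the point \<open>k + 1\<close> is not a pole, and inserting it gives the first formula. For \<open>k < m\<close> single terms
  have a simple pole at \<open>k + 1\<close> although \<open>F_m\<close> has none. So the residues cancel and the value is the
  constant term of the Laurent expansion (lemma \<open>frac_mellin_at_pole\<close>). Euler's constant comes from \<open>\<zeta>\<close> at its pole,
  the numbers \<open>\<zeta>'(-j)\<close> from the terms in which a linear factor of the denominator vanishes, and harmonic numbers from the
  logarithmic derivatives of the other factors. The harmonic number \<open>H_{k+1}\<close> is multiplied by the sum of the residues of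
  all terms with a zeta factor; this sum is \<open>0\<close> unless \<open>1 / (s - m)\<close> has a pole too, so \<open>H_{k+1}\<close> survives only for
  \<open>k = m - 1\<close>.

  What remains is \<open>a_j = (-1)^{j+1} (\<zeta>'(-j) + H_j \<zeta>(-j))\<close> (lemma \<open>a_seq_eq\<close>). The cancellation of residues at \<open>1\<close> is exactly the
  recurrence of the Bernoulli numbers, which yields \<open>\<zeta>(-j)\<close>; the logarithmic derivative of the functional
  equation yields \<open>\<zeta>'(-j)\<close> for odd \<open>j\<close>, and its sine factor yields \<open>\<zeta>(-j) = 0\<close> for even \<open>j > 0\<close>.

  The functional equation, and with it the continuation of \<open>\<zeta>\<close> to the plane, is obtained from
  \[ \zeta(s) = \frac{s (s+1)}{2} \int_0^\infty (\{u\} - \{u\}^2) u^{-s-2} du, \qquad -1 < s < 0. \]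
  The integrand is nonnegative. Writing \<open>u^{-s-2}\<close> as a Laplace integral and exchanging the integrals leaves the Laplace
  transform \<open>coth (x / 2) / x\<^sup>2 - 2 / x\<^sup>3\<close> of the periodic function \<open>{u} - {u}\<^sup>2\<close>, and its partial fractions
  integrate to the Dirichlet series of \<open>\<zeta>(1 - s)\<close>.
\<close>

section \<open>The Mellin transform of a power of the fractional part\<close>

text \<open>The contribution of \<open>u = n + 1 + t\<close>, \<open>t \<in> [0, 1]\<close>; the index is shifted because the series starts at \<open>u = 1\<close>.\<close>

definition frac_mellin_term :: "nat \<Rightarrow> complex \<Rightarrow> nat \<Rightarrow> complex" where
  "frac_mellin_term r s n =
     integral {0..1} (\<lambda>t. of_real (t ^ r) * of_real (real (Suc n) + t) powr (- s - 1))"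

text \<open>The integral of \<open>{u}^r u^{-s-1}\<close> over \<open>u \<ge> 1\<close>, cut at the integers. With a series of integrals over a fixed
compact interval, holomorphy in \<open>s\<close> is locally uniform convergence.\<close>

definition frac_mellin :: "nat \<Rightarrow> complex \<Rightarrow> complex" where
  "frac_mellin r s = (\<Sum>n. frac_mellin_term r s n)"

lemma continuous_on_frac_mellin_integrand:
  "continuous_on {0..1} (\<lambda>t. of_real (t ^ r) * of_real (real (Suc n) + t) powr (- s - 1) :: complex)"
  by (intro continuous_intros) (auto simp: complex_nonpos_Reals_iff complex_eq_iff)

lemma norm_frac_mellin_integrand_le:
  assumes "Re s \<ge> -1" "t \<in> {0..1}"
  shows "norm (of_real (t ^ r) * of_real (real (Suc n) + t) powr (- s - 1) :: complex)
           \<le> real (Suc n) powr (- Re s - 1)"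
proof -
  have "norm (complex_of_real (real (Suc n) + t) powr (- s - 1)) = (real (Suc n) + t) powr (- Re s - 1)"
    using assms by (subst norm_powr_real_powr) auto
  also have "\<dots> \<le> real (Suc n) powr (- Re s - 1)"
    using assms by (intro powr_mono2') auto
  finally have *: "norm (complex_of_real (real (Suc n) + t) powr (- s - 1)) \<le> real (Suc n) powr (- Re s - 1)" .
  have "norm (complex_of_real (t ^ r)) \<le> 1"
    using assms by (auto simp: norm_power power_le_one)
  with * have "norm (complex_of_real (t ^ r)) * norm (complex_of_real (real (Suc n) + t) powr (- s - 1)) \<le> 1 * real (Suc n) powr (- Re s - 1)"
    by (intro mult_mono) auto
  then show ?thesis by (simp only: norm_mult mult_1)
qed

lemma norm_frac_mellin_term_le:
  assumes "Re s \<ge> -1"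
  shows "norm (frac_mellin_term r s n) \<le> real (Suc n) powr (- Re s - 1)"
  using integral_bound[of 0 1 "\<lambda>t. of_real (t ^ r) * of_real (real (Suc n) + t) powr (- s - 1) :: complex"
      "real (Suc n) powr (- Re s - 1)"]
    continuous_on_frac_mellin_integrand norm_frac_mellin_integrand_le[OF assms]
  unfolding frac_mellin_term_def by simp

lemma holomorphic_frac_mellin_term: "(\<lambda>s. frac_mellin_term r s n) holomorphic_on A"
proof -
  have "(\<lambda>s. integral (cbox 0 1) (\<lambda>t. of_real (t ^ r) * of_real (real (Suc n) + t) powr (- s - 1) :: complex))
          holomorphic_on UNIV"
  proof (rule leibniz_rule_holomorphic)
    fix s :: complex and t :: real
    assume "t \<in> cbox 0 1"
    then have nz: "complex_of_real (real (Suc n) + t) \<noteq> 0"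
      by (auto simp: complex_eq_iff)
    have "((\<lambda>s. c * w powr (- s - 1)) has_field_derivative c * (- (w powr (- s - 1)) * Ln w)) (at s within UNIV)"
      if "w \<noteq> 0" for c w :: complex
    proof -
      have "((\<lambda>s. w powr (- s - 1)) has_field_derivative (Ln w * w powr (- s - 1)) * (- 1)) (at s within UNIV)"
        using that by (intro DERIV_chain2[where f = "\<lambda>z. w powr z"] has_field_derivative_powr_right)
           (auto intro!: derivative_eq_intros)
      from DERIV_cmult[OF this, of c] show ?thesis by (simp add: mult_ac)
    qed
    from this[OF nz, of "of_real (t ^ r)"]
    show "((\<lambda>s. of_real (t ^ r) * of_real (real (Suc n) + t) powr (- s - 1)) has_field_derivative
        of_real (t ^ r) * (- (of_real (real (Suc n) + t) powr (- s - 1)) * Ln (of_real (real (Suc n) + t))))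
        (at s within UNIV)" .
  next
    show "(\<lambda>t. of_real (t ^ r) * of_real (real (Suc n) + t) powr (- s - 1) :: complex) integrable_on cbox 0 1" for s
      using continuous_on_frac_mellin_integrand[of r n s] by (simp add: integrable_continuous_real)
  next
    show "continuous_on (UNIV \<times> cbox 0 1) (\<lambda>(s, t). of_real (t ^ r) *
        (- (of_real (real (Suc n) + t) powr (- s - 1)) * Ln (of_real (real (Suc n) + t))) :: complex)"
      unfolding case_prod_unfold
      by (intro continuous_intros) (auto simp: complex_nonpos_Reals_iff complex_eq_iff)
  qed auto
  then show ?thesis
    unfolding frac_mellin_term_def by (auto intro: holomorphic_on_subset)
qed

lemma summable_Suc_powr:
  assumes "d > 0"
  shows "summable (\<lambda>n. real (Suc n) powr (- d - 1))"
proof -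
  have "summable (\<lambda>n. real n powr (- d - 1))"
    using assms by (subst summable_real_powr_iff) auto
  then show ?thesis by (subst summable_Suc_iff)
qed

lemma frac_mellin_sums:
  assumes "Re s > 0"
  shows "frac_mellin_term r s sums frac_mellin r s"
proof -
  have "summable (frac_mellin_term r s)"
    by (rule summable_comparison_test'[OF summable_Suc_powr[OF assms], of 0])
       (use assms in \<open>auto intro!: norm_frac_mellin_term_le simp del: of_nat_Suc\<close>)
  then show ?thesis by (simp add: frac_mellin_def summable_sums)
qed

lemma holomorphic_frac_mellin:
  "frac_mellin r holomorphic_on {s. Re s > 0}"
proof (rule holomorphic_uniform_sequence)
  show "open {s. Re s > 0}" by (rule open_halfspace_Re_gt)
  show "(\<lambda>s. \<Sum>i<N. frac_mellin_term r s i) holomorphic_on {s. Re s > 0}" for N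
    by (intro holomorphic_intros holomorphic_frac_mellin_term)
next
  fix s :: complex assume s: "s \<in> {s. Re s > 0}"
  define d where "d = Re s / 2"
  have d: "d > 0" using s by (simp add: d_def)
  have Re_ge: "Re z \<ge> d" if "z \<in> cball s d" for z
    using that abs_Re_le_cmod[of "s - z"] by (auto simp: dist_norm d_def)
  have "uniform_limit (cball s d) (\<lambda>N s. \<Sum>i<N. frac_mellin_term r s i) (\<lambda>s. \<Sum>i. frac_mellin_term r s i) sequentially"
  proof (rule Weierstrass_m_test[OF _ summable_Suc_powr[OF d]])
    fix n z assume "z \<in> cball s d"
    then have z: "Re z \<ge> d" by (rule Re_ge)
    with d have "norm (frac_mellin_term r z n) \<le> real (Suc n) powr (- Re z - 1)"
      by (intro norm_frac_mellin_term_le) auto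
    also have "\<dots> \<le> real (Suc n) powr (- d - 1)"
      using z by (intro powr_mono) auto
    finally show "norm (frac_mellin_term r z n) \<le> real (Suc n) powr (- d - 1)" .
  qed
  then have "uniform_limit (cball s d) (\<lambda>N s. \<Sum>i<N. frac_mellin_term r s i) (frac_mellin r) sequentially"
    by (simp add: frac_mellin_def[abs_def])
  moreover have "cball s d \<subseteq> {s. Re s > 0}" using Re_ge d by force
  ultimately show "\<exists>d>0. cball s d \<subseteq> {s. Re s > 0} \<and>
      uniform_limit (cball s d) (\<lambda>N s. \<Sum>i<N. frac_mellin_term r s i) (frac_mellin r) sequentially"
    using d by blast
qed

text \<open>Integration by parts in \<open>t\<close>. The boundary term at \<open>t = 0\<close> is present only for \<open>r = 0\<close>, where it makes the
terms telescope when summed over \<open>n\<close>.\<close>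

lemma frac_mellin_term_by_parts:
  "s * frac_mellin_term r s n =
     (if r = 0 then of_nat (Suc n) powr (- s) else of_nat r * frac_mellin_term (r - 1) (s - 1) n)
     - of_nat (Suc (Suc n)) powr (- s)"
proof -
  let ?w = "\<lambda>t. complex_of_real (real (Suc n) + t)"
  have "((\<lambda>t. of_nat r * of_real t ^ (r - 1) * ?w t powr (- s) - s * (of_real (t ^ r) * ?w t powr (- s - 1)))
          has_integral (of_real (1 ^ r) * ?w 1 powr (- s) - of_real (0 ^ r) * ?w 0 powr (- s))) {0..1}"
  proof (rule fundamental_theorem_of_calculus)
    fix t :: real assume t: "t \<in> {0..1}"
    then have nz: "?w t \<noteq> 0" "?w t \<notin> \<real>\<^sub>\<le>\<^sub>0" by (auto simp: complex_eq_iff complex_nonpos_Reals_iff)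
    have "((\<lambda>z. z ^ r * (of_nat (Suc n) + z) powr (- s)) has_field_derivative
          of_nat r * of_real t ^ (r - 1) * ?w t powr (- s) - s * (of_real (t ^ r) * ?w t powr (- s - 1)))
          (at (complex_of_real t))"
      using nz by (auto intro!: derivative_eq_intros simp: field_simps)
    then have "((\<lambda>t. complex_of_real t ^ r * (of_nat (Suc n) + complex_of_real t) powr (- s)) has_vector_derivative
          of_nat r * of_real t ^ (r - 1) * ?w t powr (- s) - s * (of_real (t ^ r) * ?w t powr (- s - 1)))
          (at t within {0..1})"
      by (intro has_vector_derivative_real_field)
    then show "((\<lambda>t. of_real (t ^ r) * ?w t powr (- s)) has_vector_derivative
          of_nat r * of_real t ^ (r - 1) * ?w t powr (- s) - s * (of_real (t ^ r) * ?w t powr (- s - 1)))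
          (at t within {0..1})"
      by simp
  qed simp
  moreover have "((\<lambda>t. of_nat r * of_real t ^ (r - 1) * ?w t powr (- s) - s * (of_real (t ^ r) * ?w t powr (- s - 1)))
          has_integral (of_nat r * frac_mellin_term (r - 1) (s - 1) n - s * frac_mellin_term r s n)) {0..1}"
  proof -
    have "((\<lambda>t. of_real (t ^ (r - 1)) * ?w t powr (- (s - 1) - 1)) has_integral frac_mellin_term (r - 1) (s - 1) n) {0..1}"
      unfolding frac_mellin_term_def
      by (intro integrable_integral integrable_continuous_real continuous_on_frac_mellin_integrand)
    from has_integral_mult_right[OF this, of "of_nat r"]
    have 1: "((\<lambda>t. of_nat r * of_real t ^ (r - 1) * ?w t powr (- s)) has_integral of_nat r * frac_mellin_term (r - 1) (s - 1) n) {0..1}"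
      by (simp add: mult.assoc)
    have 2: "((\<lambda>t. of_real (t ^ r) * ?w t powr (- s - 1)) has_integral frac_mellin_term r s n) {0..1}"
      unfolding frac_mellin_term_def
      by (intro integrable_integral integrable_continuous_real continuous_on_frac_mellin_integrand)
    show ?thesis by (intro has_integral_diff 1 has_integral_mult_right 2)
  qed
  ultimately have eq: "of_real (1 ^ r) * ?w 1 powr (- s) - of_real (0 ^ r) * ?w 0 powr (- s)
      = of_nat r * frac_mellin_term (r - 1) (s - 1) n - s * frac_mellin_term r s n"
    by (rule has_integral_unique)
  have "?w 1 = of_nat (Suc (Suc n))" "?w 0 = of_nat (Suc n)" by simp_all
  with eq show ?thesis
    by (cases "r = 0") (auto simp: power_0_left algebra_simps simp del: of_nat_Suc)
qed

lemma tendsto_Suc_powr_neg: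
  assumes "Re s > 0"
  shows "(\<lambda>n. complex_of_nat (Suc n) powr (- s)) \<longlonglongrightarrow> 0"
proof -
  have "norm (complex_of_nat (Suc n) powr (- s)) = real (Suc n) powr (- Re s)" for n
    using norm_powr_real_powr[of "complex_of_nat (Suc n)" "- s"] by simp
  moreover have "(\<lambda>n. real (Suc n) powr (- Re s)) \<longlonglongrightarrow> 0"
    using assms by real_asymp
  ultimately show ?thesis by (subst tendsto_norm_zero_iff[symmetric]) simp
qed

lemma frac_mellin_0:
  assumes "Re s > 0"
  shows "frac_mellin 0 s = 1 / s"
proof -
  have "(\<lambda>n. s * frac_mellin_term 0 s n) sums (s * frac_mellin 0 s)"
    by (intro sums_mult frac_mellin_sums assms)
  moreover have "(\<lambda>n. s * frac_mellin_term 0 s n) sums (of_nat (Suc 0) powr (- s) - 0)"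
    unfolding frac_mellin_term_by_parts[of s 0]
    using telescope_sums'[OF tendsto_Suc_powr_neg[OF assms]] by simp
  ultimately have "s * frac_mellin 0 s = 1" using sums_unique2 by fastforce
  moreover have "s \<noteq> 0" using assms by auto
  ultimately show ?thesis by (simp add: field_simps)
qed

text \<open>Summed over \<open>n\<close>, the boundary terms at \<open>t = 1\<close> are the Dirichlet series of \<open>\<zeta>\<close> without its first term. The value \<open>Z\<close> of
the series is a parameter because this lemma is used both to construct \<open>\<zeta>\<close> and to compute with it.\<close>

lemma frac_mellin_by_parts:
  assumes "Re s > 1" "r > 0"
    and "(\<lambda>n. 1 / of_nat (Suc n) powr s) sums Z"
  shows "s * frac_mellin r s = 1 - Z + of_nat r * frac_mellin (r - 1) (s - 1)"
proof -
  have 1: "(\<lambda>n. s * frac_mellin_term r s n) sums (s * frac_mellin r s)"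
    using assms by (intro sums_mult frac_mellin_sums) auto
  have Z: "(\<lambda>n. of_nat (Suc (Suc n)) powr (- s)) sums (Z - 1)"
    using assms(3) sums_Suc_iff[of "\<lambda>n. of_nat (Suc n) powr (- s)" "Z - 1"] by (simp add: powr_minus field_simps)
  have 2: "(\<lambda>n. of_nat r * frac_mellin_term (r - 1) (s - 1) n - of_nat (Suc (Suc n)) powr (- s)) sums
     (of_nat r * frac_mellin (r - 1) (s - 1) - (Z - 1))"
    using assms by (intro sums_diff sums_mult frac_mellin_sums Z) auto
  show ?thesis
    using sums_unique2[OF 1, of "of_nat r * frac_mellin (r - 1) (s - 1) - (Z - 1)"] 2 assms(2)
    unfolding frac_mellin_term_by_parts[of s r] by simp
qed

lemma frac_mellin_term_of_real:
  "frac_mellin_term r (of_real x) n =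
     of_real (integral {0..1} (\<lambda>t. t ^ r * (real (Suc n) + t) powr (- x - 1)))"
proof -
  let ?f = "\<lambda>t. t ^ r * (real (Suc n) + t) powr (- x - 1)"
  have "(?f has_integral integral {0..1} ?f) {0..1}"
    by (intro integrable_integral integrable_continuous_real continuous_intros) auto
  then have "((\<lambda>t. complex_of_real (?f t)) has_integral of_real (integral {0..1} ?f)) {0..1}"
    by (rule has_integral_of_real)
  then have "((\<lambda>t. of_real (t ^ r) * of_real (real (Suc n) + t) powr (- of_real x - 1)) has_integral complex_of_real (integral {0..1} ?f)) {0..1}"
  proof (rule has_integral_eq[rotated])
    fix t :: real assume "t \<in> {0..1}"
    then have "complex_of_real ((real (Suc n) + t) powr (- x - 1)) = of_real (real (Suc n) + t) powr (of_real (- x - 1))"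
      by (intro powr_of_real [symmetric]) auto
    then show "complex_of_real (?f t) = of_real (t ^ r) * of_real (real (Suc n) + t) powr (- of_real x - 1)"
      by simp
  qed
  then show ?thesis unfolding frac_mellin_term_def by (rule integral_unique)
qed

text \<open>On \<open>[1 / (n + 2), 1 / (n + 1)]\<close> the substitution \<open>x = 1 / (n + 1 + t)\<close> produces the term of index \<open>n\<close>. The pieces exhaust
\<open>[1 / (N + 1), 1]\<close>, and the lower end may tend to \<open>0\<close> because the integrand is bounded.\<close>

lemma frac_integral_eq_frac_mellin:
  "complex_of_real (frac_integral k m) = frac_mellin m (of_nat (Suc k))"
proof -
  let ?f = "\<lambda>x::real. x ^ k * frac (1 / x) ^ m"
  let ?T = "\<lambda>n. integral {0..1} (\<lambda>t. t ^ m * (real (Suc n) + t) powr (- real (Suc k) - 1))"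
  have "(\<lambda>x. ?f x) absolutely_integrable_on {0..1}"
  proof (rule measurable_bounded_by_integrable_imp_absolutely_integrable)
    have "?f \<in> borel_measurable borel"
      unfolding frac_def by measurable
    then show "?f \<in> borel_measurable (lebesgue_on {0..1})"
      by (simp add: measurable_completion measurable_restrict_space1)
    show "(\<lambda>x::real. 1::real) integrable_on {0..1}" by (intro integrable_continuous_real continuous_intros)
    show "norm (?f x) \<le> 1" if "x \<in> {0..1}" for x
    proof -
      have "frac (1 / x) ^ m \<le> 1" by (intro power_le_one) (auto simp: frac_lt_1 less_imp_le)
      moreover have "x ^ k \<le> 1" using that by (intro power_le_one) auto
      ultimately have "x ^ k * frac (1 / x) ^ m \<le> 1 * 1"
        using that by (intro mult_mono) auto
      then show ?thesis using that by (simp add: abs_mult)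
    qed
  qed auto
  then have int: "?f integrable_on {0..1}"
    by (rule set_lebesgue_integral_eq_integral)
  have piece: "(?f has_integral ?T n) {1 / real (Suc (Suc n))..1 / real (Suc n)}" for n
  proof -
    define g where "g = (\<lambda>t. 1 / (real (Suc n) + t))"
    define h where "h = (\<lambda>x. x ^ k * (1 / x - real (Suc n)) ^ m)"
    have g01: "g 0 = 1 / real (Suc n)" "g 1 = 1 / real (Suc (Suc n))" by (auto simp: g_def add.commute)
    have lt: "g 1 < g 0" "g 1 > 0" unfolding g01 by (auto simp: field_simps)
    have cont_h: "continuous_on {g 1..g 0} h"
      unfolding h_def using lt by (intro continuous_intros) auto
    have "((\<lambda>t. (- 1 / (real (Suc n) + t)\<^sup>2) *\<^sub>R h (g t)) has_integral
            (integral {g 0..g 1} h - integral {g 1..g 0} h)) {0..1}"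
    proof (rule has_integral_substitution_general[where s = "{}" and c = "g 1" and d = "g 0"])
      show "g ` {0..1} \<subseteq> {g 1..g 0}"
        by (auto simp: g_def field_simps)
      show "continuous_on {0..1} g" unfolding g_def by (intro continuous_intros) auto
      show "(g has_field_derivative - 1 / (real (Suc n) + t)\<^sup>2) (at t within {0..1})" if "t \<in> {0..1} - {}" for t
        unfolding g_def using that
        by (auto intro!: derivative_eq_intros simp: power2_eq_square)
    qed (use cont_h in auto)
    from has_integral_neg[OF this] have "((\<lambda>t. - ((- 1 / (real (Suc n) + t)\<^sup>2) *\<^sub>R h (g t))) has_integral integral {g 1..g 0} h) {0..1}"
      using lt by simp
    then have "((\<lambda>t. t ^ m * (real (Suc n) + t) powr (- real (Suc k) - 1)) has_integral integral {g 1..g 0} h) {0..1}"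
    proof (rule has_integral_eq[rotated])
      fix t :: real assume t: "t \<in> {0..1}"
      then have pos: "real (Suc n) + t > 0" by auto
      have "(real (Suc n) + t) powr (- real (Suc k) - 1) = inverse ((real (Suc n) + t) powr real (k + 2))"
        by (subst powr_minus [symmetric]) (simp add: algebra_simps)
      also have "\<dots> = inverse ((real (Suc n) + t) ^ (k + 2))"
        using pos by (subst powr_realpow) auto
      finally show "- ((- 1 / (real (Suc n) + t)\<^sup>2) *\<^sub>R h (g t)) = t ^ m * (real (Suc n) + t) powr (- real (Suc k) - 1)"
        using pos by (simp add: h_def g_def power_divide field_simps power2_eq_square del: of_nat_Suc)
    qed
    then have T: "?T n = integral {g 1..g 0} h" by (rule integral_unique)
    have "(h has_integral integral {g 1..g 0} h) {g 1..g 0}"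
      by (intro integrable_integral integrable_continuous_real cont_h)
    then have "(?f has_integral integral {g 1..g 0} h) {g 1..g 0}"
    proof (rule has_integral_spike_finite[where S = "{g 1}", rotated 2])
      fix x assume x: "x \<in> {g 1..g 0} - {g 1}"
      then have x0: "x > 0" using lt by auto
      have "real (Suc n) \<le> 1 / x" "1 / x < real (Suc (Suc n))"
        using x x0 unfolding g01 by (auto simp: field_simps)
      then have "\<lfloor>1 / x\<rfloor> = int (Suc n)" by (intro floor_unique) auto
      then show "?f x = h x" by (simp add: h_def frac_def)
    qed auto
    then show ?thesis unfolding T g01 .
  qed
  have partial: "(?f has_integral (\<Sum>n<N. ?T n)) {1 / real (Suc N)..1}" for N
  proof (induction N)
    case 0
    then show ?case by auto
  next
    case (Suc N)
    have "(?f has_integral ?T N + (\<Sum>n<N. ?T n)) {1 / real (Suc (Suc N))..1}"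
      by (rule has_integral_combine[OF _ _ piece Suc]) (auto simp: field_simps)
    then show ?case by (simp add: add.commute)
  qed
  have "continuous_on {0..1} (\<lambda>x. integral {x..1} ?f)"
    using indefinite_integral_continuous_1'[OF int] .
  then have "((\<lambda>x. integral {x..1} ?f) \<longlongrightarrow> integral {0..1} ?f) (at 0 within {0..1})"
    by (auto simp: continuous_on_def)
  moreover have "filterlim (\<lambda>N. 1 / real (Suc N)) (at 0 within {0..1}) sequentially"
    unfolding filterlim_at by (auto intro!: always_eventually) real_asymp
  ultimately have "(\<lambda>N. integral {1 / real (Suc N)..1} ?f) \<longlonglongrightarrow> integral {0..1} ?f"
    by (rule filterlim_compose)
  then have "?T sums frac_integral k m"
    unfolding sums_def frac_integral_def integral_unique[OF partial] .
  then have "(\<lambda>n. complex_of_real (?T n)) sums of_real (frac_integral k m)"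
    by (rule sums_of_real)
  moreover have "frac_mellin_term m (of_nat (Suc k)) = (\<lambda>n. complex_of_real (?T n))"
    using frac_mellin_term_of_real[of m "real (Suc k)"] by (intro ext) (simp only: of_real_of_nat_eq)
  moreover have "frac_mellin_term m (of_nat (Suc k)) sums frac_mellin m (of_nat (Suc k))"
    by (rule frac_mellin_sums) simp
  ultimately show ?thesis by (simp add: sums_unique2 del: of_nat_Suc)
qed

section \<open>Partial fractions of the hyperbolic cotangent\<close>

text \<open>The logarithmic derivative of the reflection formula \<open>\<Gamma>(z) \<Gamma>(1 - z) = \<pi> / sin \<pi>z\<close> expresses the cotangent by two values of
the digamma function, and the series of the latter combine into the partial fractions. Using \<open>\<psi>(1 + z)\<close> in place
of \<open>\<psi>(z)\<close> removes the pole at \<open>0\<close> and makes the two series match term by term.\<close>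

lemma cot_partial_fractions:
  fixes z :: complex
  assumes "z \<notin> \<int>"
  shows "(\<lambda>k. 2 * z / (z\<^sup>2 - of_nat (Suc k) ^ 2)) sums
           (of_real pi * cos (of_real pi * z) / sin (of_real pi * z) - 1 / z)"
proof -
  have "1 - z \<notin> \<int>"
  proof
    assume "1 - z \<in> \<int>"
    from Ints_diff[OF Ints_1 this] have "z \<in> \<int>" by (simp only: diff_diff_eq2 add_diff_cancel_left')
    with assms show False by contradiction
  qed
  then have notin: "z \<notin> \<int>\<^sub>\<le>\<^sub>0" "1 - z \<notin> \<int>\<^sub>\<le>\<^sub>0"
    using assms nonpos_Ints_Int by blast+
  have nz: "z \<noteq> of_int i" for i using assms by auto
  have z0: "z \<noteq> 0" and z1: "1 + z \<noteq> 0" "1 - z \<noteq> 0"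
    using nz[of 0] nz[of "-1"] nz[of 1] by (auto simp: add_eq_0_iff)
  have sin0: "sin (of_real pi * z) \<noteq> 0"
  proof
    assume "sin (of_real pi * z) = 0"
    then obtain i :: int where "of_real pi * z = of_real (of_int i * pi)"
      unfolding sin_eq_0 by auto
    then have "of_real pi * z = of_real pi * of_int i" by (simp add: mult.commute)
    with nz[of i] show False by simp
  qed
  have "((\<lambda>z. Gamma z * Gamma (1 - z)) has_field_derivative
           Gamma z * Gamma (1 - z) * (Digamma z - Digamma (1 - z))) (at z)"
    using notin by (auto intro!: derivative_eq_intros simp: algebra_simps)
  moreover have "(\<lambda>z :: complex. Gamma z * Gamma (1 - z)) = (\<lambda>z. of_real pi / sin (of_real pi * z))"
    by (rule ext) (rule Gamma_reflection_complex)
  ultimately have "((\<lambda>z. of_real pi / sin (of_real pi * z)) has_field_derivative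
           of_real pi / sin (of_real pi * z) * (Digamma z - Digamma (1 - z))) (at z)"
    by (simp add: Gamma_reflection_complex)
  moreover have "((\<lambda>z. of_real pi / sin (of_real pi * z)) has_field_derivative
       - (of_real pi)\<^sup>2 * cos (of_real pi * z) / (sin (of_real pi * z))\<^sup>2) (at z)"
    using sin0 by (auto intro!: derivative_eq_intros simp: power2_eq_square)
  ultimately have "of_real pi / sin (of_real pi * z) * (Digamma z - Digamma (1 - z)) =
       - (of_real pi)\<^sup>2 * cos (of_real pi * z) / (sin (of_real pi * z))\<^sup>2"
    by (rule DERIV_unique)
  then have "of_real pi / sin (of_real pi * z) * (Digamma (1 - z) - Digamma z) =
       of_real pi / sin (of_real pi * z) * (of_real pi * cos (of_real pi * z) / sin (of_real pi * z))"
    by (simp add: algebra_simps power2_eq_square)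
  then have "Digamma (1 - z) - Digamma z = of_real pi * cos (of_real pi * z) / sin (of_real pi * z)"
    using sin0 by (subst (asm) mult_left_cancel) auto
  then have eq: "Digamma (1 - z) - Digamma (1 + z) = of_real pi * cos (of_real pi * z) / sin (of_real pi * z) - 1 / z"
    using Digamma_plus1[OF z0] by (simp add: add.commute algebra_simps)
  have D: "(\<lambda>k. inverse (of_nat (Suc k)) - inverse (w + of_nat k)) sums (Digamma w + euler_mascheroni)"
    if "w \<noteq> 0" for w :: complex
    using summable_sums[OF summable_Digamma[OF that]] by (simp add: Digamma_def)
  have "(\<lambda>k. inverse (1 + z + of_nat k) - inverse (1 - z + of_nat k)) sums (Digamma (1 - z) - Digamma (1 + z))"
    using sums_diff[OF D[OF z1(2)] D[OF z1(1)]] by simp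
  moreover have "inverse (1 + z + of_nat k) - inverse (1 - z + of_nat k) = 2 * z / (z\<^sup>2 - of_nat (Suc k) ^ 2)" for k
  proof -
    have "1 + z + of_nat k \<noteq> 0" "1 - z + of_nat k \<noteq> 0"
    proof -
      have "z \<noteq> - of_nat (Suc k)" "z \<noteq> of_nat (Suc k)"
        using nz[of "- int (Suc k)"] nz[of "int (Suc k)"] by simp_all
      then show "1 + z + of_nat k \<noteq> 0" "1 - z + of_nat k \<noteq> 0" by (auto simp: algebra_simps eq_neg_iff_add_eq_0)
    qed
    moreover have "inverse p - inverse q = (q - p) / (p * q)" if "p \<noteq> 0" "q \<noteq> 0" for p q :: complex
      using that by (simp add: field_simps)
    ultimately have "inverse (1 + z + of_nat k) - inverse (1 - z + of_nat k) =
        (- (2 * z)) / ((1 + z + of_nat k) * (1 - z + of_nat k))" by simp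
    also have "(1 + z + of_nat k) * (1 - z + of_nat k) = - (z\<^sup>2 - of_nat (Suc k) ^ 2)"
      by (simp add: algebra_simps power2_eq_square)
    finally show ?thesis by (simp only: minus_divide_divide)
  qed
  ultimately show ?thesis unfolding eq by simp
qed

text \<open>The cotangent series at the imaginary point \<open>z = i x / 2\<pi>\<close>.\<close>

lemma coth_partial_fractions:
  fixes x :: real
  assumes "x > 0"
  shows "(\<lambda>k. 4 * x / (x\<^sup>2 + (2 * pi * real (Suc k))\<^sup>2)) sums ((1 + exp (- x)) / (1 - exp (- x)) - 2 / x)"
proof -
  define z :: complex where "z = \<i> * of_real (x / (2 * pi))"
  have z: "z \<notin> \<int>" using assms by (auto simp: z_def complex_is_Int_iff)
  have "of_real pi * z = \<i> * of_real (x / 2)" by (simp add: z_def field_simps)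
  moreover have "\<i> * (\<i> * of_real (x / 2)) = - of_real (x / 2)" "\<i> * of_real (x/2) * \<i> = - of_real (x / 2)"
    by (simp_all add: field_simps)
  ultimately have cs: "cos (of_real pi * z) = (exp (- of_real (x / 2)) + exp (of_real (x / 2))) / 2"
     "sin (of_real pi * z) = (exp (- of_real (x / 2)) - exp (of_real (x / 2))) / (2 * \<i>)"
    unfolding cos_exp_eq sin_exp_eq by (simp_all del: of_real_divide)
  have e: "exp (- of_real (x / 2)) = complex_of_real (exp (- x / 2))" "exp (of_real (x / 2)) = complex_of_real (exp (x / 2))"
    by (metis exp_of_real of_real_minus minus_divide_left, rule exp_of_real)
  have ex: "exp (- x) = exp (- x / 2) / exp (x / 2)"
    by (simp add: exp_diff[symmetric])
  have lt: "exp (- x / 2) < exp (x / 2)" using assms by simp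
  have "of_real pi * cos (of_real pi * z) / sin (of_real pi * z) =
      - \<i> * of_real pi * of_real ((exp (- x / 2) + exp (x / 2)) / (exp (x / 2) - exp (- x / 2)))"
    unfolding cs e using lt by (simp add: field_simps flip: of_real_diff of_real_add) (simp add: field_simps)
  also have "(exp (- x / 2) + exp (x / 2)) / (exp (x / 2) - exp (- x / 2)) = (1 + exp (- x)) / (1 - exp (- x))"
    unfolding ex using lt by (simp add: field_simps)
  finally have quot: "of_real pi * cos (of_real pi * z) / sin (of_real pi * z) =
      - \<i> * of_real pi * of_real ((1 + exp (- x)) / (1 - exp (- x)))" .
  have inv: "1 / z = - \<i> * of_real (pi * (2 / x))"
    using assms by (simp add: z_def field_simps)
  have lim: "of_real pi * cos (of_real pi * z) / sin (of_real pi * z) - 1 / z =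
       - \<i> * of_real (pi * ((1 + exp (- x)) / (1 - exp (- x)) - 2 / x))"
    unfolding quot inv by (simp add: algebra_simps)
  have "2 * z / (z\<^sup>2 - of_nat (Suc k) ^ 2) = - \<i> * of_real (pi * (4 * x / (x\<^sup>2 + (2 * pi * real (Suc k))\<^sup>2)))" for k
  proof -
    have z2: "z\<^sup>2 - of_nat (Suc k) ^ 2 = - of_real ((x\<^sup>2 + (2 * pi * real (Suc k))\<^sup>2) / (4 * pi\<^sup>2))"
      by (simp add: z_def field_simps power2_eq_square)
    have zz: "2 * z = \<i> * of_real (x / pi)" by (simp add: z_def)
    have "x\<^sup>2 + (2 * pi * real (Suc k))\<^sup>2 > 0" using assms by (intro add_pos_nonneg) auto
    then have "(x / pi) / ((x\<^sup>2 + (2 * pi * real (Suc k))\<^sup>2) / (4 * pi\<^sup>2)) =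
        pi * (4 * x / (x\<^sup>2 + (2 * pi * real (Suc k))\<^sup>2))"
      by (simp add: divide_simps power2_eq_square del: of_nat_Suc)
    then show ?thesis unfolding z2 zz
      by (metis (no_types) divide_minus_right minus_mult_left of_real_divide times_divide_eq_right)
  qed
  with cot_partial_fractions[OF z] lim
  have "(\<lambda>k. - \<i> * of_real (pi * (4 * x / (x\<^sup>2 + (2 * pi * real (Suc k))\<^sup>2)))) sums
      (- \<i> * of_real (pi * ((1 + exp (- x)) / (1 - exp (- x)) - 2 / x)))" by simp
  then have "(\<lambda>k. complex_of_real (pi * (4 * x / (x\<^sup>2 + (2 * pi * real (Suc k))\<^sup>2)))) sums
      (complex_of_real (pi * ((1 + exp (- x)) / (1 - exp (- x)) - 2 / x)))"
    by (subst (asm) sums_mult_iff) auto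
  then have "(\<lambda>k. pi * (4 * x / (x\<^sup>2 + (2 * pi * real (Suc k))\<^sup>2))) sums
      (pi * ((1 + exp (- x)) / (1 - exp (- x)) - 2 / x))"
    by (simp only: sums_of_real_iff)
  then show ?thesis by (subst (asm) sums_mult_iff) auto
qed

section \<open>The Mellin transform of the periodic parabola\<close>

text \<open>Euler's integral under the substitution \<open>v = w x^p\<close>. The cases \<open>p = 1\<close> (a power as a Laplace integral) and
\<open>p = 2\<close> (a Gaussian moment) are the ones needed.\<close>

lemma Gamma_integral_power_substitution:
  fixes a w :: real
  assumes "a > 0" "w > 0" "p > 0"
  shows "((\<lambda>x. x powr (real p * a - 1) * exp (- w * x ^ p)) has_integral
            (Gamma a * w powr (- a) / real p)) {0<..}"
proof -
  define g where "g = (\<lambda>x::real. w * x ^ p)"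
  define f where "f = (\<lambda>t::real. t powr (a - 1) / exp t)"
  have "(f has_integral Gamma a) {0..}"
    unfolding f_def by (rule Gamma_integral_real) fact
  then have f: "(f has_integral Gamma a) {0<..}"
    by (subst (asm) has_integral_spike_set_eq[of _ "{0<..}"]) (auto intro: negligible_subset[of "{0}"])
  then have absf: "f absolutely_integrable_on {0<..}"
    by (intro nonnegative_absolutely_integrable_1) (auto simp: f_def)
  have img: "g ` {0<..} = {0<..}"
  proof (intro equalityI subsetI)
    fix y :: real assume "y \<in> {0<..}"
    then have "y = g (root p (y / w))" "root p (y / w) \<in> {0<..}" using assms by (auto simp: g_def real_root_pow_pos2)
    then show "y \<in> g ` {0<..}" by blast
  qed (use assms in \<open>auto simp: g_def\<close>)
  have inj: "inj_on g {0<..}"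
    using assms by (auto simp: inj_on_def g_def intro: power_eq_imp_eq_base)
  have der: "(g has_field_derivative w * (real p * x ^ (p - 1))) (at x within {0<..})" for x
    unfolding g_def by (auto intro!: derivative_eq_intros)
  have "(\<lambda>x. \<bar>w * (real p * x ^ (p - 1))\<bar> * f (g x)) absolutely_integrable_on {0<..} \<and>
      integral {0<..} (\<lambda>x. \<bar>w * (real p * x ^ (p - 1))\<bar> * f (g x)) = Gamma a"
    using has_absolute_integral_change_of_variables_1'[of "{0<..}" g, OF _ der inj, of f "Gamma a"] absf f
    unfolding img by (auto simp: integral_unique)
  then have "((\<lambda>x. \<bar>w * (real p * x ^ (p - 1))\<bar> * f (g x)) has_integral Gamma a) {0<..}"
    by (metis integrable_integral set_lebesgue_integral_eq_integral(1))
  from has_integral_mult_right[OF this, of "w powr (- a) / real p"]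
  show ?thesis
  proof (rule has_integral_eq_rhs[OF has_integral_eq, rotated])
    fix x :: real assume x: "x \<in> {0<..}"
    have xp: "x ^ q = x powr real q" for q using x by (simp add: powr_realpow)
    have "w powr (- a) * (w * (w powr (a - 1))) = w powr (- a) * (w powr 1 * w powr (a - 1))" using assms by simp
    also have "\<dots> = 1" unfolding powr_add[symmetric] using assms by simp
    finally have 1: "w powr (- a) * (w * (w powr (a - 1))) = 1" .
    have "x ^ (p - 1) * (x ^ p) powr (a - 1) = x powr (real (p - 1) + real p * (a - 1))"
      unfolding xp by (simp add: powr_powr powr_add)
    also have "real (p - 1) + real p * (a - 1) = real p * a - 1"
      using assms by (simp add: of_nat_diff algebra_simps)
    finally have 2: "x ^ (p - 1) * (x ^ p) powr (a - 1) = x powr (real p * a - 1)" .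
    have "w powr (- a) / real p * (\<bar>w * (real p * x ^ (p - 1))\<bar> * f (g x)) =
       (w powr (- a) * (w * (w powr (a - 1)))) * (x ^ (p - 1) * (x ^ p) powr (a - 1)) * exp (- w * x ^ p)"
      using assms x by (simp add: f_def g_def powr_mult exp_minus abs_mult field_simps)
    then show "w powr (- a) / real p * (\<bar>w * (real p * x ^ (p - 1))\<bar> * f (g x)) =
       x powr (real p * a - 1) * exp (- w * x ^ p)"
      unfolding 1 2 by simp
  qed auto
qed

lemma nn_integral_powr_exp:
  assumes "a > 0" "w > 0" "p > 0" 
  shows "(\<integral>\<^sup>+x. ennreal (indicator {0<..} x * (x powr (real p * a - 1) * exp (- w * x ^ p))) \<partial>lborel)
            = ennreal (Gamma a * w powr (- a) / real p)"
  using nn_integral_has_integral_lebesgue[OF _ Gamma_integral_power_substitution[OF assms]] by simp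

text \<open>Writing \<open>1 / (x\<^sup>2 + c\<^sup>2)\<close> as the integral of \<open>exp (- (x\<^sup>2 + c\<^sup>2) w)\<close> over \<open>w > 0\<close> and integrating over \<open>x\<close> first leaves
two Gamma integrals.\<close>

lemma nn_integral_powr_over_quadratic:
  assumes "0 < b" "b < 2" "c > 0"
  shows "(\<integral>\<^sup>+x. ennreal (indicator {0<..} x * (x powr (b - 1) / (x\<^sup>2 + c\<^sup>2))) \<partial>lborel)
           = ennreal (Gamma (b / 2) * Gamma (1 - b / 2) / 2 * c powr (b - 2))"
proof -
  let ?K = "\<lambda>x w. ennreal (indicator {0<..} x * (indicator {0<..} w * (x powr (b - 1) * exp (- (x\<^sup>2 + c\<^sup>2) * w))))"
  have "(\<integral>\<^sup>+x. ennreal (indicator {0<..} x * (x powr (b - 1) / (x\<^sup>2 + c\<^sup>2))) \<partial>lborel)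
      = (\<integral>\<^sup>+x. \<integral>\<^sup>+w. ?K x w \<partial>lborel \<partial>lborel)"
  proof (rule nn_integral_cong)
    fix x :: real
    show "ennreal (indicator {0<..} x * (x powr (b - 1) / (x\<^sup>2 + c\<^sup>2))) = (\<integral>\<^sup>+w. ?K x w \<partial>lborel)"
    proof (cases "x > 0")
      case True
      then have pos: "x\<^sup>2 + c\<^sup>2 > 0" using assms by (intro add_pos_pos) auto
      have "(\<integral>\<^sup>+w. ?K x w \<partial>lborel) = (\<integral>\<^sup>+w. ennreal (x powr (b - 1)) * ennreal (indicator {0<..} w * (w powr (real 1 * 1 - 1) * exp (- (x\<^sup>2 + c\<^sup>2) * w ^ 1))) \<partial>lborel)"
        by (intro nn_integral_cong) (use True in \<open>auto simp: ennreal_mult'[symmetric] indicator_def mult_ac\<close>)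
      also have "\<dots> = ennreal (x powr (b - 1)) * ennreal (Gamma 1 * (x\<^sup>2 + c\<^sup>2) powr (- 1) / real 1)"
        by (subst nn_integral_cmult, measurable) (subst nn_integral_powr_exp, use pos in auto)
      also have "\<dots> = ennreal (indicator {0<..} x * (x powr (b - 1) / (x\<^sup>2 + c\<^sup>2)))"
        using True pos by (simp add: ennreal_mult'[symmetric] powr_minus_divide)
      finally show ?thesis ..
    qed auto
  qed
  also have "\<dots> = (\<integral>\<^sup>+w. \<integral>\<^sup>+x. ?K x w \<partial>lborel \<partial>lborel)"
    by (rule lborel_pair.Fubini') measurable
  also have "\<dots> = (\<integral>\<^sup>+w. ennreal (Gamma (b / 2) / 2) * ennreal (indicator {0<..} w * (w powr (real 1 * (1 - b / 2) - 1) * exp (- c\<^sup>2 * w ^ 1))) \<partial>lborel)"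
  proof (rule nn_integral_cong)
    fix w :: real
    show "(\<integral>\<^sup>+x. ?K x w \<partial>lborel) = ennreal (Gamma (b / 2) / 2) * ennreal (indicator {0<..} w * (w powr (real 1 * (1 - b / 2) - 1) * exp (- c\<^sup>2 * w ^ 1)))"
    proof (cases "w > 0")
      case True
      have "(\<integral>\<^sup>+x. ?K x w \<partial>lborel) = (\<integral>\<^sup>+x. ennreal (exp (- c\<^sup>2 * w)) * ennreal (indicator {0<..} x * (x powr (real 2 * (b / 2) - 1) * exp (- w * x ^ 2))) \<partial>lborel)"
        by (intro nn_integral_cong) (use True in \<open>auto simp: ennreal_mult'[symmetric] indicator_def mult_ac exp_add[symmetric] ring_distribs\<close>)
      also have "\<dots> = ennreal (exp (- c\<^sup>2 * w)) * ennreal (Gamma (b / 2) * w powr (- (b / 2)) / real 2)"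
        by (subst nn_integral_cmult, measurable) (subst nn_integral_powr_exp, use True assms in auto)
      also have "\<dots> = ennreal (Gamma (b / 2) / 2) * ennreal (indicator {0<..} w * (w powr (real 1 * (1 - b / 2) - 1) * exp (- c\<^sup>2 * w ^ 1)))"
        using True assms by (simp add: ennreal_mult'[symmetric] mult_ac)
      finally show ?thesis .
    qed auto
  qed
  also have "\<dots> = ennreal (Gamma (b / 2) / 2) * ennreal (Gamma (1 - b / 2) * (c\<^sup>2) powr (- (1 - b / 2)) / real 1)"
    by (subst nn_integral_cmult, measurable) (subst nn_integral_powr_exp, use assms in auto)
  also have "(c\<^sup>2) powr (- (1 - b / 2)) = c powr (b - 2)"
  proof -
    have "c\<^sup>2 = c powr 2" using assms by (simp add: powr_numeral)
    then show ?thesis by (simp add: powr_powr algebra_simps)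
  qed
  also have "ennreal (Gamma (b / 2) / 2) * ennreal (Gamma (1 - b / 2) * c powr (b - 2) / real 1) =
      ennreal (Gamma (b / 2) * Gamma (1 - b / 2) / 2 * c powr (b - 2))"
    using assms by (simp add: ennreal_mult'[symmetric] mult_ac)
  finally show ?thesis .
qed

text \<open>The contribution of \<open>u = n + t\<close> to the integral of \<open>({u} - {u}\<^sup>2) u^{-a}\<close> over \<open>u > 0\<close>. Here \<open>n = 0\<close> is included: the parabola
vanishes at \<open>t = 0\<close>, so this term converges for \<open>a < 2\<close>.\<close>

definition parabola_mellin_term :: "real \<Rightarrow> nat \<Rightarrow> real" where
  "parabola_mellin_term a n = integral {0..1} (\<lambda>t. (t - t\<^sup>2) * (real n + t) powr (- a))"

lemma parabola_mellin_term_0: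
  fixes a :: real
  assumes "a < 2"
  shows "((\<lambda>t. (t - t\<^sup>2) * t powr (- a)) has_integral (1 / (2 - a) - 1 / (3 - a))) {0..1}"
proof -
  have "((\<lambda>t. t powr (1 - a) - t powr (2 - a)) has_integral
      (1 powr (1 - a + 1) / (1 - a + 1) - 1 powr (2 - a + 1) / (2 - a + 1))) {0..1}"
    using assms by (intro has_integral_diff has_integral_powr_from_0) auto
  then have "((\<lambda>t. t powr (1 - a) - t powr (2 - a)) has_integral (1 / (2 - a) - 1 / (3 - a))) {0..1}"
    by (simp add: algebra_simps)
  then show ?thesis
  proof (rule has_integral_eq[rotated])
    fix t :: real assume t: "t \<in> {0..1}"
    show "t powr (1 - a) - t powr (2 - a) = (t - t\<^sup>2) * t powr (- a)"
    proof (cases "t = 0")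
      case False
      then have "t powr (1 - a) = t * t powr (- a)" "t powr (2 - a) = t\<^sup>2 * t powr (- a)"
        using t powr_add[of t 1 "- a"] powr_add[of t 2 "- a"] by (auto simp: powr_numeral)
      then show ?thesis by (simp add: algebra_simps)
    qed auto
  qed
qed

lemma has_integral_parabola_mellin_term:
  fixes a :: real
  assumes "a < 2"
  shows "((\<lambda>t. (t - t\<^sup>2) * (real n + t) powr (- a)) has_integral parabola_mellin_term a n) {0..1}"
proof (cases "n = 0")
  case True
  then show ?thesis using parabola_mellin_term_0[OF assms] by (auto simp: parabola_mellin_term_def intro!: integrable_integral)
next
  case False
  then show ?thesis unfolding parabola_mellin_term_def
    by (intro integrable_integral integrable_continuous_real continuous_intros) auto
qed

lemma laplace_parabola:
  fixes x :: real
  assumes "x > 0"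
  shows "((\<lambda>t. (t - t\<^sup>2) * exp (- x * t)) has_integral
           ((1 + exp (- x)) / x\<^sup>2 - 2 * (1 - exp (- x)) / x ^ 3)) {0..1}"
proof -
  (* The antiderivative that two integrations by parts give. *)
  let ?F = "\<lambda>t. exp (- x * t) * ((t\<^sup>2 - t) / x + (2 * t - 1) / x\<^sup>2 + 2 / x ^ 3)"
  have "((\<lambda>t. (t - t\<^sup>2) * exp (- x * t)) has_integral (?F 1 - ?F 0)) {0..1}"
  proof (rule fundamental_theorem_of_calculus)
    fix t :: real assume "t \<in> {0..1}"
    have "(?F has_real_derivative (t - t\<^sup>2) * exp (- x * t)) (at t within {0..1})"
      using assms by (auto intro!: derivative_eq_intros simp: field_simps power2_eq_square power3_eq_cube)
    then show "(?F has_vector_derivative (t - t\<^sup>2) * exp (- x * t)) (at t within {0..1})"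
      by (simp add: has_real_derivative_iff_has_vector_derivative)
  qed simp
  moreover have "?F 1 - ?F 0 = (1 + exp (- x)) / x\<^sup>2 - 2 * (1 - exp (- x)) / x ^ 3"
    by (simp add: algebra_simps add_divide_distrib diff_divide_distrib)
  ultimately show ?thesis by simp
qed

text \<open>Division by \<open>1 - exp (- x)\<close> passes from the Laplace transform of one arch of the parabola to that of its periodic
continuation.\<close>

lemma laplace_parabola_partial_fractions:
  fixes x :: real
  assumes "x > 0"
  shows "(\<lambda>k. 4 / (x * (x\<^sup>2 + (2 * pi * real (Suc k))\<^sup>2))) sums
           (((1 + exp (- x)) / x\<^sup>2 - 2 * (1 - exp (- x)) / x ^ 3) / (1 - exp (- x)))"
proof -
  have "(\<lambda>k. 1 / x\<^sup>2 * (4 * x / (x\<^sup>2 + (2 * pi * real (Suc k))\<^sup>2))) sums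
          (1 / x\<^sup>2 * ((1 + exp (- x)) / (1 - exp (- x)) - 2 / x))"
    by (rule sums_mult) (rule coth_partial_fractions[OF assms])
  moreover have "1 / x\<^sup>2 * (4 * x / (x\<^sup>2 + (2 * pi * real (Suc k))\<^sup>2)) = 4 / (x * (x\<^sup>2 + (2 * pi * real (Suc k))\<^sup>2))" for k
    using assms by (simp add: power2_eq_square)
  moreover have "1 / x\<^sup>2 * ((1 + exp (- x)) / (1 - exp (- x)) - 2 / x) =
      ((1 + exp (- x)) / x\<^sup>2 - 2 * (1 - exp (- x)) / x ^ 3) / (1 - exp (- x))"
  proof -
    define e where "e = exp (- x)"
    have "e < 1" using assms by (simp add: e_def)
    then show ?thesis unfolding e_def[symmetric] using assms
      by (simp add: field_simps power2_eq_square power3_eq_cube)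
  qed
  ultimately show ?thesis by simp
qed

text \<open>The analytic core of the functional equation. With \<open>\<Gamma>(a) y^{-a}\<close> written as the integral of \<open>x^{a-1} exp (- x y)\<close> over \<open>x > 0\<close>,
every integrand and every series term is nonnegative, so integrals and sums may be exchanged freely in
\<open>[0, \<infinity>]\<close>. The \<open>t\<close>-integral and the sum over \<open>n\<close> then become the periodic Laplace transform, and its partial fractions
are integrated against \<open>x^{a-1}\<close> one by one. Finiteness of the result proves convergence on the left-hand side.\<close>

lemma parabola_mellin_term_sums:
  fixes a :: real
  assumes "1 < a" "a < 2"
  shows "parabola_mellin_term a sums
           (2 * (2 * pi) powr (a - 3) * (Gamma ((a - 1) / 2) * Gamma (1 - (a - 1) / 2)) / Gamma a *
             (\<Sum>k. real (Suc k) powr (a - 3)))"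
proof -
  define I where "I = (\<lambda>x::real. (1 + exp (- x)) / x\<^sup>2 - 2 * (1 - exp (- x)) / x ^ 3)"
  define c where "c = (\<lambda>k. 2 * pi * real (Suc k))"
  define G where "G = Gamma ((a - 1) / 2) * Gamma (1 - (a - 1) / 2)"
  let ?K = "\<lambda>n t x. ennreal (indicator {0..1} t * (indicator {0<..} x * ((t - t\<^sup>2) * (x powr (a - 1) * exp (- (real n + t) * x)))))"
  have parabola_nonneg: "0 \<le> t - t\<^sup>2" if "t \<in> {0..1}" for t :: real
    using that by (auto simp: power2_eq_square mult_left_le)
  have Gamma_pos: "Gamma a > 0" using assms by simp
  have Gpos: "G > 0" using assms by (simp add: G_def)
  have summable: "summable (\<lambda>k. real (Suc k) powr (a - 3))"
    using summable_Suc_powr[of "2 - a"] assms by simp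
  have I_nonneg: "I x \<ge> 0" if "x > 0" for x
    unfolding I_def using laplace_parabola[OF that] by (rule has_integral_nonneg) (use parabola_nonneg in auto)
  (* Integrated over x, ?K is Gamma a times the integrand of the n-th summand; integrated over t, it is
     x powr (a - 1) * exp (- n * x) times the Laplace transform of one arch. *)
  have step_x: "(\<integral>\<^sup>+x. ?K n t x \<partial>lborel) =
      ennreal (Gamma a) * ennreal (indicator {0..1} t * ((t - t\<^sup>2) * (real n + t) powr (- a)))" for n t
  proof (cases "t \<in> {0..1} \<and> real n + t > 0")
    case True
    have "(\<integral>\<^sup>+x. ?K n t x \<partial>lborel) = (\<integral>\<^sup>+x. ennreal (t - t\<^sup>2) * ennreal (indicator {0<..} x * (x powr (real 1 * a - 1) * exp (- (real n + t) * x ^ 1))) \<partial>lborel)"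
      by (intro nn_integral_cong) (use True parabola_nonneg[of t] in \<open>auto simp: ennreal_mult'[symmetric] indicator_def mult_ac\<close>)
    also have "\<dots> = ennreal (t - t\<^sup>2) * ennreal (Gamma a * (real n + t) powr (- a) / real 1)"
      by (subst nn_integral_cmult, measurable) (subst nn_integral_powr_exp, use True assms in auto)
    also have "\<dots> = ennreal (Gamma a) * ennreal (indicator {0..1} t * ((t - t\<^sup>2) * (real n + t) powr (- a)))"
      using True parabola_nonneg[of t] Gamma_pos by (simp add: ennreal_mult'[symmetric] mult_ac)
    finally show ?thesis .
  next
    case False
    then have "t \<notin> {0..1} \<or> t = 0" by auto
    then show ?thesis by auto
  qed
  have step_t: "(\<integral>\<^sup>+t. ?K n t x \<partial>lborel) =
      ennreal (indicator {0<..} x * (x powr (a - 1) * I x)) * ennreal (exp (- x) ^ n)" for n x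
  proof (cases "x > 0")
    case True
    have "(\<integral>\<^sup>+t. ?K n t x \<partial>lborel) = (\<integral>\<^sup>+t. ennreal (x powr (a - 1) * exp (- x) ^ n) * ennreal (indicator {0..1} t * ((t - t\<^sup>2) * exp (- x * t))) \<partial>lborel)"
    proof (intro nn_integral_cong)
      fix t
      have "exp (- (real n + t) * x) = exp (- x) ^ n * exp (- x * t)"
        by (simp add: exp_of_nat_mult[symmetric] exp_add[symmetric] algebra_simps)
      then show "?K n t x = ennreal (x powr (a - 1) * exp (- x) ^ n) * ennreal (indicator {0..1} t * ((t - t\<^sup>2) * exp (- x * t)))"
        using True by (simp add: ennreal_mult'[symmetric] mult_ac)
    qed
    also have "\<dots> = ennreal (x powr (a - 1) * exp (- x) ^ n) * ennreal (I x)"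
      unfolding I_def
      by (subst nn_integral_cmult, measurable)
         (subst nn_integral_has_integral_lebesgue[OF _ laplace_parabola[OF True]], use parabola_nonneg in auto)
    also have "\<dots> = ennreal (indicator {0<..} x * (x powr (a - 1) * I x)) * ennreal (exp (- x) ^ n)"
      using True I_nonneg[OF True] by (simp add: ennreal_mult'[symmetric] mult_ac)
    finally show ?thesis .
  qed auto
  have step_n: "(\<Sum>n. ennreal (indicator {0<..} x * (x powr (a - 1) * I x)) * ennreal (exp (- x) ^ n)) =
     (\<Sum>k. 4 * ennreal (indicator {0<..} x * (x powr ((a - 1) - 1) / (x\<^sup>2 + (c k)\<^sup>2))))" for x
  proof (cases "x > 0")
    case True
    have "(\<lambda>n. x powr (a - 1) * I x * exp (- x) ^ n) sums (x powr (a - 1) * I x * (1 / (1 - exp (- x))))"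
      using True by (intro sums_mult geometric_sums) auto
    then have "(\<lambda>n. ennreal (x powr (a - 1) * I x * exp (- x) ^ n)) sums ennreal (x powr (a - 1) * I x * (1 / (1 - exp (- x))))"
      using True I_nonneg[OF True] by (subst sums_ennreal) auto
    then have 1: "(\<Sum>n. ennreal (x powr (a - 1) * I x * exp (- x) ^ n)) = ennreal (x powr (a - 1) * (I x / (1 - exp (- x))))"
      by (simp add: sums_iff)
    have "(\<lambda>k. x powr (a - 1) * (4 / (x * (x\<^sup>2 + (c k)\<^sup>2)))) sums (x powr (a - 1) * (I x / (1 - exp (- x))))"
      unfolding c_def I_def by (intro sums_mult laplace_parabola_partial_fractions True)
    then have "(\<lambda>k. ennreal (x powr (a - 1) * (4 / (x * (x\<^sup>2 + (c k)\<^sup>2))))) sums ennreal (x powr (a - 1) * (I x / (1 - exp (- x))))"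
      using True I_nonneg[OF True] by (subst sums_ennreal) (auto intro!: mult_nonneg_nonneg divide_nonneg_nonneg)
    then have 2: "(\<Sum>k. ennreal (x powr (a - 1) * (4 / (x * (x\<^sup>2 + (c k)\<^sup>2))))) = ennreal (x powr (a - 1) * (I x / (1 - exp (- x))))"
      by (simp add: sums_iff)
    have "ennreal (x powr (a - 1) * (4 / (x * (x\<^sup>2 + (c k)\<^sup>2)))) = 4 * ennreal (indicator {0<..} x * (x powr ((a - 1) - 1) / (x\<^sup>2 + (c k)\<^sup>2)))" for k
    proof -
      have "x powr (a - 1) = x * x powr ((a - 1) - 1)"
        using True powr_add[of x 1 "a - 1 - 1"] by simp
      then have "x powr (a - 1) * (4 / (x * (x\<^sup>2 + (c k)\<^sup>2))) = 4 * (x powr ((a - 1) - 1) / (x\<^sup>2 + (c k)\<^sup>2))"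
        using True by simp
      moreover have "ennreal (4 * y) = 4 * ennreal y" for y :: real
        by (simp add: ennreal_mult')
      moreover have "indicator {0<..} x = (1::real)" using True by simp
      ultimately show ?thesis by (simp only: mult_1)
    qed
    then show ?thesis
      using 1 2 True I_nonneg[OF True] by (simp add: ennreal_mult'[symmetric])
  qed auto
  have "(\<Sum>n. ennreal (Gamma a) * ennreal (parabola_mellin_term a n)) = (\<Sum>n. \<integral>\<^sup>+t. \<integral>\<^sup>+x. ?K n t x \<partial>lborel \<partial>lborel)"
  proof (intro suminf_cong)
    fix n
    have "(\<integral>\<^sup>+t. \<integral>\<^sup>+x. ?K n t x \<partial>lborel \<partial>lborel) =
       ennreal (Gamma a) * (\<integral>\<^sup>+t. ennreal (indicator {0..1} t * ((t - t\<^sup>2) * (real n + t) powr (- a))) \<partial>lborel)"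
      unfolding step_x by (rule nn_integral_cmult) measurable
    also have "(\<integral>\<^sup>+t. ennreal (indicator {0..1} t * ((t - t\<^sup>2) * (real n + t) powr (- a))) \<partial>lborel) = ennreal (parabola_mellin_term a n)"
      by (rule nn_integral_has_integral_lebesgue[OF _ has_integral_parabola_mellin_term])
         (use parabola_nonneg assms in auto)
    finally show "ennreal (Gamma a) * ennreal (parabola_mellin_term a n) = (\<integral>\<^sup>+t. \<integral>\<^sup>+x. ?K n t x \<partial>lborel \<partial>lborel)" ..
  qed
  also have "\<dots> = (\<Sum>n. \<integral>\<^sup>+x. \<integral>\<^sup>+t. ?K n t x \<partial>lborel \<partial>lborel)"
    by (intro suminf_cong lborel_pair.Fubini') measurable
  also have "\<dots> = (\<integral>\<^sup>+x. (\<Sum>n. ennreal (indicator {0<..} x * (x powr (a - 1) * I x)) * ennreal (exp (- x) ^ n)) \<partial>lborel)"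
    unfolding step_t I_def by (rule nn_integral_suminf[symmetric]) measurable
  also have "\<dots> = (\<Sum>k. \<integral>\<^sup>+x. 4 * ennreal (indicator {0<..} x * (x powr ((a - 1) - 1) / (x\<^sup>2 + (c k)\<^sup>2))) \<partial>lborel)"
    unfolding step_n by (rule nn_integral_suminf) measurable
  also have "\<dots> = (\<Sum>k. ennreal (2 * (2 * pi) powr (a - 3) * G * real (Suc k) powr (a - 3)))"
  proof (intro suminf_cong)
    fix k
    have "c k > 0" by (simp add: c_def)
    have "(\<integral>\<^sup>+x. 4 * ennreal (indicator {0<..} x * (x powr ((a - 1) - 1) / (x\<^sup>2 + (c k)\<^sup>2))) \<partial>lborel)
        = 4 * ennreal (G / 2 * c k powr ((a - 1) - 2))"
      unfolding G_def by (subst nn_integral_cmult, measurable)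
        (subst nn_integral_powr_over_quadratic, use assms \<open>c k > 0\<close> in auto)
    also have "\<dots> = ennreal (4 * (G / 2 * c k powr ((a - 1) - 2)))"
      by (simp only: ennreal_mult'[of 4] ennreal_numeral zero_le_numeral)
    also have "c k powr ((a - 1) - 2) = (2 * pi) powr (a - 3) * real (Suc k) powr (a - 3)"
      by (simp add: c_def powr_mult)
    finally show "(\<integral>\<^sup>+x. 4 * ennreal (indicator {0<..} x * (x powr ((a - 1) - 1) / (x\<^sup>2 + (c k)\<^sup>2))) \<partial>lborel) =
       ennreal (2 * (2 * pi) powr (a - 3) * G * real (Suc k) powr (a - 3))"
      by (simp add: mult_ac)
  qed
  also have "\<dots> = ennreal (2 * (2 * pi) powr (a - 3) * G * (\<Sum>k. real (Suc k) powr (a - 3)))"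
  proof -
    have "(\<lambda>k. 2 * (2 * pi) powr (a - 3) * G * real (Suc k) powr (a - 3)) sums
        (2 * (2 * pi) powr (a - 3) * G * (\<Sum>k. real (Suc k) powr (a - 3)))"
      by (intro sums_mult summable_sums summable)
    moreover have "0 \<le> (\<Sum>k. real (Suc k) powr (a - 3))"
      by (intro suminf_nonneg summable) auto
    ultimately have "(\<lambda>k. ennreal (2 * (2 * pi) powr (a - 3) * G * real (Suc k) powr (a - 3))) sums
        ennreal (2 * (2 * pi) powr (a - 3) * G * (\<Sum>k. real (Suc k) powr (a - 3)))"
      using Gpos by (subst sums_ennreal) auto
    then show ?thesis by (simp add: sums_iff)
  qed
  finally have eq: "(\<Sum>n. ennreal (Gamma a) * ennreal (parabola_mellin_term a n)) =
      ennreal (2 * (2 * pi) powr (a - 3) * G * (\<Sum>k. real (Suc k) powr (a - 3)))" (is "_ = ennreal ?R") .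
  have pos: "parabola_mellin_term a n \<ge> 0" for n
    using has_integral_parabola_mellin_term[OF assms(2), of n]
    by (rule has_integral_nonneg) (use parabola_nonneg in auto)
  have Rpos: "0 \<le> ?R" using Gpos by (intro mult_nonneg_nonneg suminf_nonneg summable) auto
  have "(\<lambda>n. ennreal (Gamma a * parabola_mellin_term a n)) sums ennreal ?R"
    using eq Gamma_pos pos by (simp add: sums_iff ennreal_mult'[symmetric] less_imp_le)
  then have "(\<lambda>n. Gamma a * parabola_mellin_term a n) sums ?R"
    using Gamma_pos pos Rpos by (subst (asm) sums_ennreal) auto
  then have "(\<lambda>n. inverse (Gamma a) * (Gamma a * parabola_mellin_term a n)) sums (inverse (Gamma a) * ?R)"
    by (rule sums_mult)
  then show ?thesis using Gamma_pos by (simp add: G_def field_simps)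
qed

section \<open>Continuation and functional equation of the zeta function\<close>

definition zeta_series :: "complex \<Rightarrow> complex" where
  "zeta_series s = (\<Sum>n. 1 / of_nat (Suc n) powr s)"

lemma zeta_series_sums:
  assumes "Re s > 1"
  shows "(\<lambda>n. 1 / of_nat (Suc n) powr s) sums zeta_series s"
proof -
  have "norm (1 / of_nat (Suc n) powr s) = real (Suc n) powr (- (Re s - 1) - 1)" for n
    using norm_powr_real_powr[of "of_nat (Suc n)" s] by (simp add: norm_divide powr_minus_divide)
  then have "summable (\<lambda>n. 1 / of_nat (Suc n) powr s)"
    by (intro summable_norm_cancel[where f = "\<lambda>n. 1 / of_nat (Suc n) powr s"])
       (use summable_Suc_powr[of "Re s - 1"] assms in simp)
  then show ?thesis by (simp add: zeta_series_def summable_sums)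
qed

lemma zeta_series_eq_frac_mellin_1:
  assumes "Re s > 1"
  shows "zeta_series s = 1 + 1 / (s - 1) - s * frac_mellin 1 s"
  using frac_mellin_by_parts[OF assms, of 1, OF _ zeta_series_sums[OF assms]] frac_mellin_0[of "s - 1"] assms
  by (simp add: algebra_simps)

lemma holomorphic_frac_mellin_shift:
  assumes "\<And>s. s \<in> A \<Longrightarrow> Re (s + c) > 0"
  shows "(\<lambda>s. frac_mellin r (s + c)) holomorphic_on A"
  by (rule holomorphic_on_compose_gen[OF _ holomorphic_frac_mellin, unfolded o_def])
     (use assms in \<open>auto intro!: holomorphic_intros\<close>)

lemma holomorphic_zeta_series: "zeta_series holomorphic_on {s. Re s > 1}"
proof -
  have "(\<lambda>s. 1 + 1 / (s - 1) - s * frac_mellin 1 (s + 0)) holomorphic_on {s. Re s > 1}"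
    by (intro holomorphic_intros holomorphic_frac_mellin_shift) auto
  then show ?thesis
    by (rule holomorphic_transform) (simp add: zeta_series_eq_frac_mellin_1)
qed

text \<open>Two integrations by parts continue the Dirichlet series to \<open>Re s > -1\<close>; the combination \<open>F_1 - F_2\<close> is the Mellin
transform of \<open>{u} - {u}\<^sup>2\<close> over \<open>u \<ge> 1\<close>.\<close>

definition zeta_strip :: "complex \<Rightarrow> complex" where
  "zeta_strip s = 1 / 2 + 1 / (s - 1) + s * (s + 1) / 2 * (frac_mellin 1 (s + 1) - frac_mellin 2 (s + 1))"

lemma zeta_series_eq_zeta_strip:
  assumes "Re s > 1"
  shows "zeta_series s = zeta_strip s"
proof -
  have s: "s \<noteq> 0" "s - 1 \<noteq> 0" using assms by auto
  have 1: "s * frac_mellin 1 s = 1 + 1 / (s - 1) - zeta_series s"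
    using zeta_series_eq_frac_mellin_1[OF assms] by simp
  have Z: "(\<lambda>n. 1 / of_nat (Suc n) powr (s + 1)) sums zeta_series (s + 1)"
    using assms by (intro zeta_series_sums) auto
  have 2: "(s + 1) * frac_mellin 2 (s + 1) = 1 - zeta_series (s + 1) + 2 * frac_mellin 1 s"
    using frac_mellin_by_parts[OF _ _ Z, of 2] assms by simp
  have 3: "(s + 1) * frac_mellin 1 (s + 1) = 1 - zeta_series (s + 1) + 1 / s"
    using frac_mellin_by_parts[OF _ _ Z, of 1] frac_mellin_0[of s] assms by simp
  have "zeta_strip s = 1 / 2 + 1 / (s - 1) + s / 2 * ((s + 1) * frac_mellin 1 (s + 1) - (s + 1) * frac_mellin 2 (s + 1))"
    by (simp add: zeta_strip_def right_diff_distrib[symmetric])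
  also have "\<dots> = 1 / 2 + 1 / (s - 1) + (s * (1 / s) / 2 - s * frac_mellin 1 s)"
    unfolding 2 3 by (simp add: field_simps)
  also have "\<dots> = zeta_series s"
    unfolding 1 using s by simp
  finally show ?thesis ..
qed

text \<open>The right-hand side of the functional equation, with the Dirichlet series in place of \<open>\<zeta>(1 - s)\<close>.\<close>

definition zeta_reflected :: "complex \<Rightarrow> complex" where
  "zeta_reflected s = 2 * (of_real (2 * pi)) powr (s - 1) * sin (of_real pi * s / 2) * Gamma (1 - s) * zeta_series (1 - s)"

lemma holomorphic_zeta_reflected: "zeta_reflected holomorphic_on {s. Re s < 0}"
proof -
  have "1 - s \<notin> \<int>\<^sub>\<le>\<^sub>0" if "Re s < 0" for s
    using that by (auto elim!: nonpos_Ints_cases simp: complex_eq_iff)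
  moreover have "(\<lambda>s. zeta_series (1 - s)) holomorphic_on {s. Re s < 0}"
    by (rule holomorphic_on_compose_gen[OF _ holomorphic_zeta_series, unfolded o_def])
       (auto intro!: holomorphic_intros)
  ultimately show ?thesis
    unfolding zeta_reflected_def[abs_def] by (intro holomorphic_intros) auto
qed

lemma Gamma_reflection_real: "Gamma x * Gamma (1 - x :: real) = pi / sin (pi * x)"
proof -
  have "complex_of_real (Gamma x * Gamma (1 - x)) = Gamma (of_real x) * Gamma (1 - of_real x)"
    using Gamma_complex_of_real[of "1 - x"] by (simp add: Gamma_complex_of_real)
  also have "\<dots> = of_real pi / sin (of_real pi * of_real x)"
    by (rule Gamma_reflection_complex)
  also have "sin (of_real pi * of_real x) = complex_of_real (sin (pi * x))"
    unfolding sin_of_real[symmetric] by simp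
  finally show ?thesis by (simp only: of_real_divide[symmetric] of_real_eq_iff)
qed

text \<open>For \<open>-1 < x < 0\<close> the integral of \<open>({u} - {u}\<^sup>2) u^{-x-2}\<close> over \<open>0 < u < 1\<close> converges and accounts exactly for the
rational terms \<open>1 / 2 + 1 / (x - 1)\<close>. So the continuation is a multiple of the integral over all \<open>u > 0\<close>, whose value is
known; the reflection formula of \<open>\<Gamma>\<close> puts it in the usual shape.\<close>

lemma zeta_strip_eq_reflected_real:
  fixes x :: real
  assumes "-1 < x" "x < 0"
  shows "zeta_strip (of_real x) = zeta_reflected (of_real x)"
proof -
  define a where "a = x + 2"
  define S where "S = (\<Sum>k. real (Suc k) powr (x - 1))"
  define R where "R = 2 * (2 * pi) powr (x - 1) * (Gamma ((x + 1) / 2) * Gamma (1 - (x + 1) / 2)) / Gamma a * S"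
  have R: "parabola_mellin_term a sums R"
    using parabola_mellin_term_sums[of a] assms by (simp add: a_def R_def S_def algebra_simps)
  have P0: "parabola_mellin_term a 0 = 1 / (- x) - 1 / (1 - x)"
    using integral_unique[OF parabola_mellin_term_0[of a]] assms by (simp add: parabola_mellin_term_def a_def algebra_simps)
  have "(\<lambda>n. complex_of_real (parabola_mellin_term a (Suc n))) sums of_real (R - parabola_mellin_term a 0)"
    by (intro sums_of_real) (use R in \<open>simp add: sums_Suc_iff\<close>)
  moreover have "(\<lambda>n. frac_mellin_term 1 (of_real x + 1) n - frac_mellin_term 2 (of_real x + 1) n) sums
      (frac_mellin 1 (of_real x + 1) - frac_mellin 2 (of_real x + 1))"
    using assms by (intro sums_diff frac_mellin_sums) auto
  moreover have "frac_mellin_term 1 (of_real x + 1) n - frac_mellin_term 2 (of_real x + 1) n =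
      complex_of_real (parabola_mellin_term a (Suc n))" for n
  proof -
    let ?p = "\<lambda>r t. t ^ r * (real (Suc n) + t) powr (- (x + 1) - 1)"
    have "(\<lambda>t. ?p r t) integrable_on {0..1}" for r
      by (intro integrable_continuous_real continuous_intros) auto
    then have "integral {0..1} (?p 1) - integral {0..1} (?p 2) = integral {0..1} (\<lambda>t. ?p 1 t - ?p 2 t)"
      by (intro integral_diff[symmetric])
    also have "(\<lambda>t. ?p 1 t - ?p 2 t) = (\<lambda>t. (t - t\<^sup>2) * (real (Suc n) + t) powr (- a))"
      by (simp add: a_def algebra_simps)
    finally have "integral {0..1} (?p 1) - integral {0..1} (?p 2) = parabola_mellin_term a (Suc n)"
      by (simp add: parabola_mellin_term_def)
    moreover have "complex_of_real x + 1 = of_real (x + 1)" by simp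
    ultimately show ?thesis by (simp only: frac_mellin_term_of_real of_real_diff[symmetric])
  qed
  ultimately have "frac_mellin 1 (of_real x + 1) - frac_mellin 2 (of_real x + 1) = complex_of_real (R - parabola_mellin_term a 0)"
    by (simp add: sums_unique2)
  then have "zeta_strip (of_real x) = of_real (1 / 2 + 1 / (x - 1) + x * (x + 1) / 2 * (R - parabola_mellin_term a 0))"
    unfolding zeta_strip_def by simp
  (* The term of index 0 is the contribution of 0 < u < 1; it absorbs the rational terms. *)
  also have "1 / 2 + 1 / (x - 1) + x * (x + 1) / 2 * (R - parabola_mellin_term a 0) = x * (x + 1) / 2 * R"
    unfolding P0 using assms by (simp add: divide_simps) (simp add: algebra_simps)
  also have "\<dots> = 2 * (2 * pi) powr (x - 1) * sin (pi * x / 2) * Gamma (1 - x) * S"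
  proof -
    have notin: "x \<notin> \<int>\<^sub>\<le>\<^sub>0" "x + 1 \<notin> \<int>\<^sub>\<le>\<^sub>0"
      using assms by (auto elim!: nonpos_Ints_cases)
    have "Gamma (x + 2) = (x + 1) * (x * Gamma x)"
      using Gamma_plus1[OF notin(1)] Gamma_plus1[OF notin(2)] by (simp add: add.assoc)
    moreover have Gx: "Gamma x \<noteq> 0" using notin by (simp add: Gamma_eq_zero_iff)
    ultimately have "x * (x + 1) / Gamma (x + 2) = 1 / Gamma x"
      using assms by simp
    moreover have "1 / Gamma x = Gamma (1 - x) * sin (pi * x) / pi"
    proof -
      have "sin (pi * x) \<noteq> 0"
      proof
        assume "sin (pi * x) = 0"
        then have "Gamma (1 - x) = 0" using Gamma_reflection_real[of x] Gx by simp
        moreover have "Gamma (1 - x) > 0" using assms by (intro Gamma_real_pos) simp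
        ultimately show False by simp
      qed
      then show ?thesis using Gamma_reflection_real[of x] Gx by (simp add: field_simps)
    qed
    moreover have "sin (pi * x) = 2 * sin (pi * x / 2) * cos (pi * x / 2)"
      using sin_double[of "pi * x / 2"] by simp
    ultimately have 1: "x * (x + 1) / Gamma a = Gamma (1 - x) * (2 * sin (pi * x / 2) * cos (pi * x / 2)) / pi"
      by (simp add: a_def)
    have "sin (pi * ((x + 1) / 2)) = cos (pi * x / 2)"
      using sin_cos_eq[of "pi * ((x + 1) / 2)"] by (simp add: cos_diff sin_add cos_add algebra_simps add_divide_distrib)
    then have 2: "Gamma ((x + 1) / 2) * Gamma (1 - (x + 1) / 2) = pi / cos (pi * x / 2)"
      using Gamma_reflection_real[of "(x + 1) / 2"] by simp
    have "pi * (- 1) < pi * x" using assms by (intro mult_strict_left_mono) auto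
    moreover have "pi * x < pi * 0" using assms by (intro mult_strict_left_mono) auto
    ultimately have c: "cos (pi * x / 2) > 0" by (intro cos_gt_zero_pi) linarith+
    have "x * (x + 1) / 2 * R = (2 * pi) powr (x - 1) * (pi / cos (pi * x / 2)) * (x * (x + 1) / Gamma a) * S"
      unfolding R_def 2 by simp
    also have "\<dots> = 2 * (2 * pi) powr (x - 1) * sin (pi * x / 2) * Gamma (1 - x) * S"
      unfolding 1 using c by simp
    finally show ?thesis .
  qed
  finally have eq: "zeta_strip (of_real x) = of_real (2 * (2 * pi) powr (x - 1) * sin (pi * x / 2) * Gamma (1 - x) * S)" .
  have S_eq: "complex_of_real S = zeta_series (1 - of_real x)"
  proof -
    have "summable (\<lambda>k. real (Suc k) powr (- (- x) - 1))" using assms by (intro summable_Suc_powr) auto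
    then have "(\<lambda>k. complex_of_real (real (Suc k) powr (x - 1))) sums of_real S"
      unfolding S_def by (intro sums_of_real summable_sums) simp
    moreover have "complex_of_real (real (Suc k) powr (x - 1)) = 1 / of_nat (Suc k) powr (1 - of_real x)" for k
    proof -
      have "complex_of_real (real (Suc k) powr (x - 1)) = of_nat (Suc k) powr (- (1 - of_real x))"
        using powr_of_real[of "real (Suc k)" "x - 1"] by simp
      then show ?thesis by (simp only: powr_minus divide_inverse mult_1)
    qed
    ultimately show ?thesis by (simp add: zeta_series_def sums_iff)
  qed
  have powr_eq: "complex_of_real ((2 * pi) powr (x - 1)) = of_real (2 * pi) powr (of_real x - 1)"
    using powr_of_real[of "2 * pi" "x - 1"] by simp
  have sin_eq: "complex_of_real (sin (pi * x / 2)) = sin (of_real pi * of_real x / 2)"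
    unfolding sin_of_real[symmetric] by simp
  have Gamma_eq: "complex_of_real (Gamma (1 - x)) = Gamma (1 - of_real x)"
    using Gamma_complex_of_real[of "1 - x"] by simp
  show ?thesis
    unfolding eq zeta_reflected_def powr_eq[symmetric] sin_eq[symmetric] Gamma_eq[symmetric] S_eq[symmetric]
    by (simp only: of_real_mult of_real_numeral)
qed

lemma zeta_strip_eq_reflected:
  assumes "-1 < Re s" "Re s < 0"
  shows "zeta_strip s = zeta_reflected s"
proof -
  let ?S = "{s. -1 < Re s} \<inter> {s. Re s < 0}"
  let ?U = "complex_of_real ` {-1<..<0}"
  have "zeta_strip s - zeta_reflected s = 0"
  proof (rule analytic_continuation[of "\<lambda>s. zeta_strip s - zeta_reflected s" ?S ?U "- 1 / 2"])
    have "zeta_strip holomorphic_on ?S"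
      unfolding zeta_strip_def[abs_def]
      by (intro holomorphic_intros holomorphic_frac_mellin_shift) auto
    moreover have "zeta_reflected holomorphic_on ?S"
      by (rule holomorphic_on_subset[OF holomorphic_zeta_reflected]) auto
    ultimately show "(\<lambda>s. zeta_strip s - zeta_reflected s) holomorphic_on ?S"
      by (rule holomorphic_on_diff)
    show "open ?S" by (intro open_Int open_halfspace_Re_gt open_halfspace_Re_lt)
    show "connected ?S"
      by (intro convex_connected convex_Int convex_halfspace_Re_gt convex_halfspace_Re_lt)
    show "- 1 / 2 islimpt ?U"
    proof -
      define x where "x = (\<lambda>n. - 1 / 2 + 1 / (real n + 3))"
      have "x \<longlonglongrightarrow> - 1 / 2" unfolding x_def by real_asymp
      then have "(\<lambda>n. complex_of_real (x n)) \<longlonglongrightarrow> of_real (- 1 / 2)" by (rule tendsto_of_real)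
      moreover have "x n \<in> {-1<..<0}" "complex_of_real (x n) \<noteq> - 1 / 2" for n
      proof -
        have "1 / (real n + 3) > 0" "1 / (real n + 3) \<le> 1 / 3" by (auto simp: field_simps)
        then have "x n \<noteq> - 1 / 2" "x n \<in> {-1<..<0}" unfolding x_def greaterThanLessThan_iff by linarith+
        then show "x n \<in> {-1<..<0}" "complex_of_real (x n) \<noteq> - 1 / 2"
          by (auto simp: complex_eq_iff)
      qed
      ultimately show ?thesis
        unfolding islimpt_sequential by (intro exI[of _ "\<lambda>n. of_real (x n)"]) auto
    qed
  qed (use assms zeta_strip_eq_reflected_real in auto)
  then show ?thesis by simp
qed

text \<open>The two halves \<open>Re s > -1\<close> and \<open>Re s < 0\<close> cover the plane, and the expressions given on them agree on the common strip.\<close>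

lemma zeta_continuation_exists:
  "\<exists>f. f holomorphic_on (- {1}) \<and> (\<forall>s. Re s > 1 \<longrightarrow> f s = zeta_series s) \<and>
       (\<forall>s. Re s < 0 \<longrightarrow> f s = zeta_reflected s)"
proof -
  define f where "f = (\<lambda>s. if Re s > -1 then zeta_strip s else zeta_reflected s)"
  have refl: "f s = zeta_reflected s" if "Re s < 0" for s
    using zeta_strip_eq_reflected[of s] that by (simp add: f_def)
  have ser: "f s = zeta_series s" if "Re s > 1" for s
    using zeta_series_eq_zeta_strip[OF that] that by (simp add: f_def)
  have "zeta_strip holomorphic_on ({s. Re s > -1} - {1})"
    unfolding zeta_strip_def[abs_def]
    by (intro holomorphic_intros holomorphic_frac_mellin_shift) auto
  then have 1: "f holomorphic_on ({s. Re s > -1} - {1})"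
    by (rule holomorphic_transform) (simp add: f_def)
  have 2: "f holomorphic_on {s. Re s < 0}"
    by (rule holomorphic_transform[OF holomorphic_zeta_reflected]) (simp add: refl)
  have "f holomorphic_on (({s. Re s > -1} - {1}) \<union> {s. Re s < 0})"
    by (intro holomorphic_on_Un 1 2 open_Diff open_halfspace_Re_gt open_halfspace_Re_lt) auto
  moreover have "({s. Re s > -1} - {1}) \<union> {s. Re s < 0} = - {1}"
    by auto
  ultimately have "f holomorphic_on (- {1})" by simp
  with refl ser show ?thesis by blast
qed

text \<open>The continuation just constructed shows that the description used in the choice can be met.\<close>

lemma riemann_zeta_spec:
  shows holomorphic_riemann_zeta: "riemann_zeta holomorphic_on (- {1})"
    and riemann_zeta_sums: "Re s > 1 \<Longrightarrow> (\<lambda>n. 1 / of_nat (Suc n) powr s) sums riemann_zeta s"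
proof -
  let ?P = "\<lambda>f. f holomorphic_on (- {1}) \<and>
     (\<forall>s. Re s > 1 \<longrightarrow> (\<lambda>n. 1 / of_nat (Suc n) powr s) sums f s)"
  obtain f where "f holomorphic_on (- {1})" "\<forall>s. Re s > 1 \<longrightarrow> f s = zeta_series s"
    using zeta_continuation_exists by auto
  then have "?P f" by (simp add: zeta_series_sums del: of_nat_Suc)
  then have "?P riemann_zeta" unfolding riemann_zeta_def by (rule someI[where P = ?P])
  then show "riemann_zeta holomorphic_on (- {1})"
    and "Re s > 1 \<Longrightarrow> (\<lambda>n. 1 / of_nat (Suc n) powr s) sums riemann_zeta s"
    by simp_all
qed

text \<open>The punctured plane is connected, so the chosen continuation coincides with the one constructed, for which the
equation holds by construction.\<close>

lemma zeta_functional_equation: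
  assumes "Re s < 0"
  shows "riemann_zeta s = 2 * (of_real (2 * pi)) powr (s - 1) * sin (of_real pi * s / 2) * Gamma (1 - s) * riemann_zeta (1 - s)"
proof -
  have series: "riemann_zeta s = zeta_series s" if "Re s > 1" for s
    using riemann_zeta_sums[OF that] zeta_series_sums[OF that] by (rule sums_unique2)
  obtain f where f: "f holomorphic_on (- {1})" "\<forall>s. Re s > 1 \<longrightarrow> f s = zeta_series s"
    "\<forall>s. Re s < 0 \<longrightarrow> f s = zeta_reflected s"
    using zeta_continuation_exists by auto
  have "riemann_zeta s = f s"
  proof (rule analytic_continuation_open[of "{s. Re s > 1}" "- {1}" riemann_zeta f])
    show "{s. Re s > 1} \<noteq> {}" by (auto intro!: exI[of _ "2 :: complex"])
    show "connected (- {1} :: complex set)"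
      by (intro connected_punctured_universe) auto
  qed (use f series holomorphic_riemann_zeta assms open_halfspace_Re_gt in auto)
  also have "\<dots> = zeta_reflected s" using f(3) assms by blast
  finally show ?thesis
    using series[of "1 - s"] assms by (simp add: zeta_reflected_def)
qed

section \<open>Expansion of the Mellin transform in zeta values\<close>

text \<open>The falling factorial, a denominator in the iterated integration by parts.\<close>

definition falling_prod :: "nat \<Rightarrow> complex \<Rightarrow> complex" where
  "falling_prod n s = (\<Prod>l<n. s - of_nat l)"

lemma falling_prod_Suc_shift: "falling_prod (Suc n) s = s * falling_prod n (s - 1)"
  unfolding falling_prod_def by (subst prod.lessThan_Suc_shift) (simp add: algebra_simps)

lemma falling_prod_eq_0_iff: "falling_prod n s = 0 \<longleftrightarrow> (\<exists>l<n. s = of_nat l)"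
  by (auto simp: falling_prod_def)

lemma falling_prod_of_nat:
  assumes "n \<le> p"
  shows "falling_prod n (of_nat p) = fact p / fact (p - n)"
  using assms
proof (induction n arbitrary: p)
  case 0
  then show ?case by (simp add: falling_prod_def)
next
  case (Suc n)
  then obtain q where q: "p = Suc q" "n \<le> q" by (cases p) auto
  then show ?case using Suc.IH[OF q(2)] by (simp add: falling_prod_Suc_shift)
qed

definition frac_mellin_coeff :: "nat \<Rightarrow> nat \<Rightarrow> complex" where
  "frac_mellin_coeff r i = fact r / fact (r - i)"

text \<open>Iterated integration by parts. The constants \<open>1\<close> from the individual steps have been summed into the rational
term: it obeys \<open>Q_{r+1}(s) = 1 / s + (r + 1) Q_r(s - 1) / s\<close> with \<open>Q_0(s) = 1 / s\<close>, whose solution is \<open>1 / (s - r)\<close>.\<close>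

lemma frac_mellin_expansion_right:
  assumes "Re s > real r"
  shows "frac_mellin r s = 1 / (s - of_nat r) -
           (\<Sum>i<r. frac_mellin_coeff r i / falling_prod (Suc i) s * riemann_zeta (s - of_nat i))"
  using assms
proof (induction r arbitrary: s)
  case 0
  then show ?case by (simp add: frac_mellin_0)
next
  case (Suc r)
  have s: "Re s > 1" "s \<noteq> 0" "s - of_nat (Suc r) \<noteq> 0" using Suc.prems by (auto simp: complex_eq_iff)
  have IH: "frac_mellin r (s - 1) = 1 / (s - 1 - of_nat r) -
      (\<Sum>i<r. frac_mellin_coeff r i / falling_prod (Suc i) (s - 1) * riemann_zeta (s - 1 - of_nat i))"
    using Suc.prems by (intro Suc.IH) auto
  have "s * frac_mellin (Suc r) s = 1 - riemann_zeta s + of_nat (Suc r) * frac_mellin r (s - 1)"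
    using frac_mellin_by_parts[OF s(1), of "Suc r", OF _ riemann_zeta_sums[OF s(1)]] by simp
  then have "frac_mellin (Suc r) s = 1 / s - riemann_zeta s / s + of_nat (Suc r) * frac_mellin r (s - 1) / s"
    using s(2) by (simp add: add_divide_distrib[symmetric] diff_divide_distrib[symmetric] eq_divide_eq mult.commute del: of_nat_Suc)
  also have "of_nat (Suc r) * frac_mellin r (s - 1) / s = of_nat (Suc r) / (s * (s - of_nat (Suc r))) -
      (\<Sum>i<r. of_nat (Suc r) * frac_mellin_coeff r i / (s * falling_prod (Suc i) (s - 1)) * riemann_zeta (s - 1 - of_nat i))"
    unfolding IH by (simp add: sum_distrib_left sum_divide_distrib right_diff_distrib diff_divide_distrib algebra_simps)
  also have "(\<Sum>i<r. of_nat (Suc r) * frac_mellin_coeff r i / (s * falling_prod (Suc i) (s - 1)) * riemann_zeta (s - 1 - of_nat i)) =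
     (\<Sum>i<r. frac_mellin_coeff (Suc r) (Suc i) / falling_prod (Suc (Suc i)) s * riemann_zeta (s - of_nat (Suc i)))"
    by (intro sum.cong refl) (simp add: falling_prod_Suc_shift[of _ s] frac_mellin_coeff_def diff_diff_eq add.commute)
  also have "1 / s - riemann_zeta s / s + (of_nat (Suc r) / (s * (s - of_nat (Suc r))) - (\<Sum>i<r. frac_mellin_coeff (Suc r) (Suc i) / falling_prod (Suc (Suc i)) s * riemann_zeta (s - of_nat (Suc i))))
     = (1 / s + of_nat (Suc r) / (s * (s - of_nat (Suc r)))) - (\<Sum>i<Suc r. frac_mellin_coeff (Suc r) i / falling_prod (Suc i) s * riemann_zeta (s - of_nat i))"
    by (subst sum.lessThan_Suc_shift) (simp add: falling_prod_def frac_mellin_coeff_def del: fact_Suc)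
  also have "1 / s + of_nat (Suc r) / (s * (s - of_nat (Suc r))) = 1 / (s - of_nat (Suc r))"
    using s by (simp add: divide_simps del: of_nat_Suc)
  finally show ?case .
qed

lemma holomorphic_zeta_shift:
  assumes "\<And>s. s \<in> A \<Longrightarrow> s - c \<noteq> 1"
  shows "(\<lambda>s. riemann_zeta (s - c)) holomorphic_on A"
  by (rule holomorphic_on_compose_gen[OF _ holomorphic_riemann_zeta, unfolded o_def])
     (use assms in \<open>auto intro!: holomorphic_intros\<close>)

lemma holomorphic_falling_prod [holomorphic_intros]: "falling_prod n holomorphic_on A"
  unfolding falling_prod_def[abs_def] by (intro holomorphic_intros)

text \<open>The left-hand side is holomorphic for \<open>Re s > 0\<close>, and the right-hand side too except at \<open>0, \<dots>, r\<close>; removing finitely many points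
keeps the half-plane connected.\<close>

lemma frac_mellin_expansion:
  assumes "Re s > 0" "s \<notin> of_nat ` {..r}"
  shows "frac_mellin r s = 1 / (s - of_nat r) -
           (\<Sum>i<r. frac_mellin_coeff r i / falling_prod (Suc i) s * riemann_zeta (s - of_nat i))"
proof (rule analytic_continuation_open[of "{s. Re s > real r}" "{s. Re s > 0} - of_nat ` {..r}" "frac_mellin r"])
  show "{s. Re s > real r} \<noteq> {}" by (auto intro!: exI[of _ "of_nat (Suc r)"])
  show "connected ({s. Re s > 0} - of_nat ` {..r})"
    by (intro connected_open_delete_finite open_halfspace_Re_gt convex_connected convex_halfspace_Re_gt) auto
  show "open ({s. Re s > 0} - of_nat ` {..r})"
    by (intro open_Diff open_halfspace_Re_gt finite_imp_closed) auto
  show "frac_mellin r holomorphic_on {s. Re s > 0} - of_nat ` {..r}"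
    by (rule holomorphic_on_subset[OF holomorphic_frac_mellin]) auto
  show "(\<lambda>s. 1 / (s - of_nat r) -
           (\<Sum>i<r. frac_mellin_coeff r i / falling_prod (Suc i) s * riemann_zeta (s - of_nat i)))
        holomorphic_on {s. Re s > 0} - of_nat ` {..r}"
  proof (intro holomorphic_intros holomorphic_zeta_shift)
    fix i s assume "i \<in> {..<r}" "s \<in> {s. Re s > 0} - complex_of_nat ` {..r}"
    moreover from this have "complex_of_nat (Suc i) \<in> of_nat ` {..r}" by (intro imageI) auto
    ultimately have "s \<noteq> of_nat (Suc i)" by blast
    then show "s - of_nat i \<noteq> 1" by (auto simp: algebra_simps)
  qed (auto simp: falling_prod_eq_0_iff)
  show "{s. Re s > real r} \<subseteq> {s. Re s > 0} - of_nat ` {..r}" by auto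
qed (use assms frac_mellin_expansion_right open_halfspace_Re_gt in auto)

text \<open>The partial sums are \<open>1 - (H_N - log N)\<close>. This is where Euler's constant enters.\<close>

lemma frac_mellin_1_1: "frac_mellin 1 1 = 1 - euler_mascheroni"
proof -
  have piece: "frac_mellin_term 1 1 n =
      of_real (ln (real (Suc (Suc n))) - ln (real (Suc n)) - 1 / real (Suc (Suc n)))" for n
  proof -
    have "((\<lambda>t. (real (Suc n) + t) powr (- 1)) has_integral (ln (real (Suc n) + 1) - ln (real (Suc n) + 0))) {0..1}"
      by (intro fundamental_theorem_of_calculus)
         (auto intro!: derivative_eq_intros simp: powr_minus_divide has_real_derivative_iff_has_vector_derivative[symmetric])
    then have "frac_mellin_term 0 (of_real 0) n = of_real (ln (real (Suc (Suc n))) - ln (real (Suc n)))"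
      unfolding frac_mellin_term_of_real by (simp add: integral_unique add.commute)
    then show ?thesis
      using frac_mellin_term_by_parts[of 1 1 n] by (simp add: powr_minus_divide del: of_nat_Suc)
  qed
  have partial: "(\<Sum>n<N. ln (real (Suc (Suc n))) - ln (real (Suc n)) - 1 / real (Suc (Suc n))) =
      1 - (harm (Suc N) - ln (real (Suc N)))" for N
    by (induction N) (simp_all add: harm_Suc harm_def inverse_eq_divide algebra_simps)
  have "(\<lambda>N. 1 - (harm (Suc N) - ln (real (Suc N)))) \<longlonglongrightarrow> 1 - euler_mascheroni"
    by (intro tendsto_intros LIMSEQ_Suc[OF euler_mascheroni_LIMSEQ])
  then have "(\<lambda>n. ln (real (Suc (Suc n))) - ln (real (Suc n)) - 1 / real (Suc (Suc n))) sums (1 - euler_mascheroni)"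
    unfolding sums_def partial .
  then have "frac_mellin_term 1 1 sums of_real (1 - euler_mascheroni)"
    unfolding piece by (rule sums_of_real)
  moreover have "frac_mellin_term 1 1 sums frac_mellin 1 1" by (rule frac_mellin_sums) simp
  ultimately show ?thesis by (simp add: sums_unique2)
qed

text \<open>\<open>\<zeta>(s) = 1 / (s - 1) + \<gamma> + O(s - 1)\<close>, as a statement about \<open>\<eta>(s) = (s - 1) \<zeta>(s)\<close>. It follows from the
expansion of \<open>F_1\<close>, whose value at \<open>1\<close> is known.\<close>

lemma has_field_derivative_zeta_pole_removed:
  "\<exists>\<eta>. (\<forall>s. Re s > 0 \<longrightarrow> s \<noteq> 1 \<longrightarrow> riemann_zeta s = \<eta> s / (s - 1)) \<and>
       \<eta> 1 = 1 \<and> (\<eta> has_field_derivative euler_mascheroni) (at 1)"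
proof -
  (* This is (s - 1) * zeta s rewritten by the expansion for r = 1, which makes sense at s = 1. *)
  define \<eta> where "\<eta> = (\<lambda>s. 1 + (s - 1) * (1 - s * frac_mellin 1 s))"
  have 1: "riemann_zeta s = \<eta> s / (s - 1)" if "Re s > 0" "s \<noteq> 1" for s
  proof -
    have "s \<notin> of_nat ` {..1}" using that by (auto simp: atMost_Suc)
    with that have "frac_mellin 1 s = 1 / (s - 1) - riemann_zeta s / s"
      using frac_mellin_expansion[of s 1] by (simp add: frac_mellin_coeff_def falling_prod_def)
    moreover have "s \<noteq> 0" using that by auto
    ultimately show ?thesis using that by (simp add: \<eta>_def field_simps)
  qed
  have 2: "\<eta> 1 = 1" by (simp add: \<eta>_def)
  have "(frac_mellin 1 has_field_derivative deriv (frac_mellin 1) 1) (at 1)"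
    by (rule holomorphic_derivI[OF holomorphic_frac_mellin open_halfspace_Re_gt]) simp
  then have "(\<eta> has_field_derivative euler_mascheroni) (at 1)"
    unfolding \<eta>_def by (auto intro!: derivative_eq_intros simp: frac_mellin_1_1[unfolded One_nat_def])
  with 1 2 show ?thesis by blast
qed

text \<open>If \<open>R(s) + N(s) / (s - p)\<close> stays bounded near \<open>p\<close>, the residue \<open>N(p)\<close> vanishes and the difference quotient of \<open>N\<close> gives
the limit.\<close>

lemma removable_pole_limit:
  fixes F R N :: "complex \<Rightarrow> complex"
  assumes "isCont F p" "isCont R p" "(N has_field_derivative D) (at p)"
    and "eventually (\<lambda>s. F s = R s + N s / (s - p)) (at p)"
  shows "N p = 0" "F p = R p + D"
proof -
  have FR: "((\<lambda>s. F s - R s) \<longlongrightarrow> F p - R p) (at p)"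
    using assms(1,2) by (intro tendsto_diff) (auto simp: isCont_def)
  have ev: "eventually (\<lambda>s. F s - R s = N s / (s - p)) (at p)"
    using assms(4) by eventually_elim simp
  have "((\<lambda>s. (F s - R s) * (s - p)) \<longlongrightarrow> (F p - R p) * (p - p)) (at p)"
    by (intro tendsto_intros FR)
  moreover have "eventually (\<lambda>s. (F s - R s) * (s - p) = N s) (at p)"
    using ev eventually_at_filter[of "\<lambda>s. s \<noteq> p" p UNIV]
    by (auto simp: eventually_at_filter elim!: eventually_mono)
  ultimately have "(N \<longlongrightarrow> 0) (at p)"
    using tendsto_cong by force
  moreover have "(N \<longlongrightarrow> N p) (at p)"
    using DERIV_isCont[OF assms(3)] by (simp add: isCont_def)
  ultimately show N0: "N p = 0" using tendsto_unique[of "at p"] by force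
  have "((\<lambda>s. N s / (s - p)) \<longlongrightarrow> D) (at p)"
    using assms(3) N0 by (simp add: has_field_derivative_iff)
  moreover have "((\<lambda>s. N s / (s - p)) \<longlongrightarrow> F p - R p) (at p)"
    using FR ev by (rule Lim_transform_eventually)
  ultimately have "D = F p - R p" using tendsto_unique[of "at p"] by force
  then show "F p = R p + D" by simp
qed

section \<open>The value at an integer where terms have poles\<close>

lemma harm_altdef: "harm n = (\<Sum>i<n. inverse (of_nat (Suc i)))"
  by (induction n) (simp_all add: harm_Suc harm_expand)

lemma sum_lessThan_add:
  "(\<Sum>i<a + b. f i) = (\<Sum>i<a. f i) + (\<Sum>j<b. f (a + j :: nat) :: 'a :: comm_monoid_add)"
  by (induction b) (simp_all add: add.assoc)

text \<open>At \<open>s = p\<close> the factors are \<open>p, \<dots>, 1\<close>, so the logarithmic derivative is \<open>H_p\<close>.\<close>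

lemma has_field_derivative_falling_prod_at_top:
  "(falling_prod p has_field_derivative fact p * harm p) (at (of_nat p))"
proof -
  have "(falling_prod p has_field_derivative
      falling_prod p (of_nat p) * (\<Sum>l<p. 1 / (of_nat p - of_nat l))) (at (of_nat p))"
    unfolding falling_prod_def[abs_def]
    by (rule has_field_derivative_prod') (auto intro!: derivative_eq_intros)
  moreover have "(\<Sum>l<p. 1 / (of_nat p - of_nat l)) = (harm p :: complex)"
  proof -
    have "(\<Sum>l<p. 1 / (of_nat p - of_nat l)) = (\<Sum>l<p. inverse (complex_of_nat (Suc (p - Suc l))))"
      by (intro sum.cong refl) (auto simp: Suc_diff_Suc of_nat_diff inverse_eq_divide simp del: of_nat_Suc)
    also have "\<dots> = harm p"
      unfolding harm_altdef by (rule sum.nat_diff_reindex)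
    finally show ?thesis .
  qed
  ultimately show ?thesis by (simp add: falling_prod_of_nat)
qed

lemma falling_prod_neg1: "falling_prod j (- 1) = (- 1) ^ j * fact j"
  by (induction j) (simp_all add: falling_prod_def algebra_simps)

text \<open>At \<open>s = -1\<close> the factors are \<open>-1, \<dots>, -j\<close>, so the logarithmic derivative is \<open>- H_j\<close>.\<close>

lemma has_field_derivative_falling_prod_at_neg1:
  "(falling_prod j has_field_derivative - ((-1) ^ j * fact j * harm j)) (at (- 1))"
proof -
  have "(falling_prod j has_field_derivative
      falling_prod j (- 1) * (\<Sum>l<j. 1 / (- 1 - of_nat l))) (at (- 1))"
    unfolding falling_prod_def[abs_def]
    by (rule has_field_derivative_prod') (auto intro!: derivative_eq_intros simp: complex_eq_iff)
  moreover have "(\<Sum>l<j. 1 / (- 1 - complex_of_nat l)) = (\<Sum>l<j. - inverse (of_nat (Suc l)))"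
    by (intro sum.cong refl) (simp add: inverse_eq_divide divide_minus_right[symmetric] del: divide_minus_right)
  then have "(\<Sum>l<j. 1 / (- 1 - complex_of_nat l)) = - harm j"
    by (simp add: harm_altdef sum_negf)
  ultimately show ?thesis by (simp add: falling_prod_neg1)
qed

lemma falling_prod_Suc: "falling_prod (Suc n) s = falling_prod n s * (s - of_nat n)"
  by (simp add: falling_prod_def)

text \<open>Isolates the factor \<open>s - p\<close>, which causes the pole; near \<open>s = p\<close> the last product is evaluated near \<open>-1\<close>.\<close>

lemma falling_prod_split:
  "falling_prod (Suc (p + j)) s = falling_prod p s * (s - of_nat p) * falling_prod j (s - of_nat p - 1)"
proof (induction j)
  case 0
  then show ?case by (simp add: falling_prod_def)
next
  case (Suc j)
  have "falling_prod (Suc (p + Suc j)) s = falling_prod (Suc (p + j)) s * (s - of_nat (Suc (p + j)))"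
    by (simp add: falling_prod_Suc)
  also have "s - of_nat (Suc (p + j)) = s - of_nat p - 1 - of_nat j" by simp
  finally show ?case unfolding Suc falling_prod_Suc[of j] by (simp only: mult.assoc)
qed

text \<open>The quotient rule for a denominator given by its logarithmic derivative \<open>L\<close>.\<close>

lemma has_field_derivative_quotient_log:
  fixes f h :: "complex \<Rightarrow> complex"
  assumes "(f has_field_derivative D) (at x)" "(h has_field_derivative h x * L) (at x)" "h x \<noteq> 0"
  shows "((\<lambda>s. f s / h s) has_field_derivative (D - f x * L) / h x) (at x)"
proof -
  have "(D * h x - f x * (h x * L)) / (h x * h x) = (D - f x * L) * h x / (h x * h x)"
    by (simp add: algebra_simps)
  also have "\<dots> = (D - f x * L) / h x" using assms(3) by simp
  finally show ?thesis using DERIV_divide[OF assms] by simp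
qed

text \<open>The expansion of \<open>F_m\<close> near an integer \<open>p = k + 1 \<le> m\<close>. The terms with \<open>i < k\<close> are regular there, the term \<open>i = k\<close> has the pole of
\<open>\<zeta>\<close> at \<open>1\<close>, and the terms \<open>i = p + j\<close> have a vanishing denominator and the numerator \<open>\<zeta>(s - p - j)\<close>, evaluated near \<open>-j\<close>.
The rational term \<open>1 / (s - m)\<close> is singular only for \<open>m = p\<close>, that is \<open>e = 0\<close>. The first claim is the
vanishing of the total residue, the second the resulting value; \<open>H_p\<close> multiplies the residues of all terms
with a \<open>\<zeta>\<close>-factor, and by the first claim these add up to \<open>1\<close> or \<open>0\<close>.\<close>

lemma frac_mellin_at_pole:
  fixes k e :: nat
  defines "p \<equiv> Suc k"
  defines "m \<equiv> p + e"
  defines "d \<equiv> \<lambda>j. frac_mellin_coeff m (p + j) * (-1) ^ j / (fact p * fact j)"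
  shows "(if e = 0 then 1 else 0) - frac_mellin_coeff m k / fact p
           - (\<Sum>j<e. d j * riemann_zeta (- of_nat j)) = 0" (is ?th1)
    and "frac_mellin m (of_nat p) =
           (if e = 0 then harm p else 1 / (of_nat p - of_nat m))
           - (\<Sum>i<k. frac_mellin_coeff m i / falling_prod (Suc i) (of_nat p) * riemann_zeta (of_nat p - of_nat i))
           - frac_mellin_coeff m k / fact p * euler_mascheroni
           - (\<Sum>j<e. d j * (deriv riemann_zeta (- of_nat j) + harm j * riemann_zeta (- of_nat j)))" (is ?th2)
proof -
  obtain \<eta> where \<eta>: "\<forall>s. Re s > 0 \<longrightarrow> s \<noteq> 1 \<longrightarrow> riemann_zeta s = \<eta> s / (s - 1)"
    "\<eta> 1 = 1" "(\<eta> has_field_derivative euler_mascheroni) (at 1)"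
    using has_field_derivative_zeta_pole_removed by blast
  define c where "c = frac_mellin_coeff m"
  define P where "P = complex_of_nat p"
  define A where "A = falling_prod p"
  define B where "B = (\<lambda>j s. falling_prod j (s - P - 1))"
  (* R collects the terms regular at P; N is (s - P) times the remaining ones. *)
  define R where "R = (\<lambda>s. (if e = 0 then 0 else 1 / (s - of_nat m)) -
      (\<Sum>i<k. c i / falling_prod (Suc i) s * riemann_zeta (s - of_nat i)))"
  define N where "N = (\<lambda>s. (if e = 0 then 1 else 0) - c k * (\<eta> (s - of_nat k) / A s)
      - (\<Sum>j<e. c (p + j) * (riemann_zeta (s - of_nat (p + j)) / (A s * B j s))))"
  have Pk: "P - of_nat k = 1" by (simp add: P_def p_def)
  have Ppj: "P - of_nat (p + j) = - of_nat j" for j by (simp add: P_def)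
  have A: "A P = fact p" by (simp add: A_def P_def falling_prod_of_nat)
  have B: "B j P = (- 1) ^ j * fact j" for j by (simp add: B_def falling_prod_neg1)
  have A': "(A has_field_derivative A P * harm p) (at P)"
    unfolding A using has_field_derivative_falling_prod_at_top[of p] by (simp add: A_def P_def)
  have B': "(B j has_field_derivative B j P * (- harm j)) (at P)" for j
  proof -
    have "(falling_prod j has_field_derivative - ((-1) ^ j * fact j * harm j)) (at (P - P - 1))"
      using has_field_derivative_falling_prod_at_neg1[of j] by simp
    then have "((\<lambda>s. falling_prod j (s - P - 1)) has_field_derivative - ((-1) ^ j * fact j * harm j) * 1) (at P)"
      by (rule DERIV_chain2[where f = "falling_prod j"]) (auto intro!: derivative_eq_intros)
    then show ?thesis unfolding B by (simp add: B_def)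
  qed
  have AB': "((\<lambda>s. A s * B j s) has_field_derivative (A P * B j P) * (harm p - harm j)) (at P)" for j
    using DERIV_mult[OF A' B'] by (rule DERIV_cong) (simp add: algebra_simps)
  have \<eta>': "((\<lambda>s. \<eta> (s - of_nat k)) has_field_derivative euler_mascheroni * 1) (at P)"
    by (rule DERIV_chain2[where f = \<eta>]) (use \<eta>(3) in \<open>auto intro!: derivative_eq_intros simp: P_def p_def\<close>)
  have zeta': "((\<lambda>s. riemann_zeta (s - of_nat (p + j))) has_field_derivative deriv riemann_zeta (- of_nat j) * 1) (at P)" for j
  proof (rule DERIV_chain2[where f = riemann_zeta and g = "\<lambda>s. s - of_nat (p + j)"])
    have "- complex_of_nat j \<noteq> 1" by (simp add: complex_eq_iff)
    then have "(riemann_zeta has_field_derivative deriv riemann_zeta (- of_nat j)) (at (- of_nat j))"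
      by (intro holomorphic_derivI[OF holomorphic_riemann_zeta]) auto
    then show "(riemann_zeta has_field_derivative deriv riemann_zeta (- of_nat j)) (at (P - of_nat (p + j)))"
      by (simp add: P_def)
  qed (auto intro!: derivative_eq_intros)
  have "((\<lambda>s. \<eta> (s - of_nat k) / A s) has_field_derivative (euler_mascheroni - harm p) / fact p) (at P)"
    using has_field_derivative_quotient_log[OF \<eta>' A'] by (simp add: A Pk \<eta>(2) del: fact_Suc)
  moreover have "((\<lambda>s. riemann_zeta (s - of_nat (p + j)) / (A s * B j s)) has_field_derivative
      (deriv riemann_zeta (- of_nat j) - riemann_zeta (- of_nat j) * (harm p - harm j)) / (fact p * ((- 1) ^ j * fact j))) (at P)" for j
    using has_field_derivative_quotient_log[OF zeta'[of j] AB'[of j]] by (simp add: A B Ppj del: of_nat_add fact_Suc)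
  ultimately have N': "(N has_field_derivative
      0 - c k * ((euler_mascheroni - harm p) / fact p) -
      (\<Sum>j<e. c (p + j) * ((deriv riemann_zeta (- of_nat j) - riemann_zeta (- of_nat j) * (harm p - harm j)) / (fact p * ((- 1) ^ j * fact j))))) (at P)"
    (is "(N has_field_derivative ?D) (at P)")
    unfolding N_def by (intro DERIV_diff DERIV_const DERIV_cmult DERIV_sum)
  have d: "c (p + j) * (x / (fact p * ((- 1) ^ j * fact j))) = d j * x" for j x
    by (cases "even j") (simp_all add: d_def c_def)
  have contF: "isCont (frac_mellin m) P"
    using holomorphic_derivI[OF holomorphic_frac_mellin open_halfspace_Re_gt, of P m]
    by (intro DERIV_isCont) (auto simp: P_def p_def)
  have contR: "isCont R P"
  proof -
    have "isCont (\<lambda>s. riemann_zeta (s - of_nat i)) P" if "i < k" for i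
    proof -
      have "P - of_nat i \<noteq> 1" using that by (simp add: P_def p_def complex_eq_iff)
      then have "isCont riemann_zeta (P - of_nat i)"
        by (intro DERIV_isCont[OF holomorphic_derivI[OF holomorphic_riemann_zeta]]) auto
      then show ?thesis by (intro isCont_o2[of P "\<lambda>s. s - of_nat i" riemann_zeta]) auto
    qed
    moreover have "isCont (falling_prod i) P" for i
      unfolding falling_prod_def[abs_def] by (intro continuous_intros)
    moreover have "falling_prod (Suc i) P \<noteq> 0" if "i < k" for i
      using that falling_prod_of_nat[of "Suc i" p] by (simp add: P_def p_def del: fact_Suc)
    moreover have "isCont (\<lambda>s. if e = 0 then 0 else 1 / (s - of_nat m)) P"
      by (cases "e = 0") (auto simp: P_def m_def intro!: continuous_intros)
    ultimately show ?thesis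
      unfolding R_def by (intro continuous_intros) auto
  qed
  have "frac_mellin m s = R s + N s / (s - P)" if s: "s \<noteq> P" "dist s P < 1 / 2" for s
  proof -
    (* The radius 1/2 excludes every integer other than p, hence all other poles. *)
    have "\<bar>Re s - real p\<bar> < 1 / 2" using abs_Re_le_cmod[of "s - P"] s by (simp add: dist_norm P_def)
    then have Re: "Re s > 0" "Re (s - of_nat k) > 0"
      unfolding p_def minus_complex.simps complex_Re_of_nat by linarith+
    have notin: "s \<noteq> of_nat n" for n
    proof
      assume "s = of_nat n"
      then have "\<bar>real n - real p\<bar> < 1 / 2" using \<open>\<bar>Re s - real p\<bar> < 1 / 2\<close> by simp
      then have "n = p" by linarith
      with \<open>s = of_nat n\<close> s show False by (simp add: P_def)
    qed
    have ne: "s - of_nat k \<noteq> 1" using s by (auto simp: P_def p_def algebra_simps)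
    let ?T = "\<lambda>i. c i / falling_prod (Suc i) s * riemann_zeta (s - of_nat i)"
    have "frac_mellin m s = 1 / (s - of_nat m) - (\<Sum>i<m. ?T i)"
      unfolding c_def using notin Re by (intro frac_mellin_expansion) auto
    also have "(\<Sum>i<m. ?T i) = (\<Sum>i<k. ?T i) + ?T k + (\<Sum>j<e. ?T (p + j))"
      unfolding m_def p_def by (simp only: sum_lessThan_add sum.lessThan_Suc)
    also have "?T k = c k * (\<eta> (s - of_nat k) / A s) / (s - P)"
      using \<eta>(1)[rule_format, OF Re(2) ne] by (simp add: A_def P_def p_def algebra_simps)
    also have "(\<Sum>j<e. ?T (p + j)) = (\<Sum>j<e. c (p + j) * (riemann_zeta (s - of_nat (p + j)) / (A s * B j s))) / (s - P)"
      unfolding sum_divide_distrib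
      by (intro sum.cong refl) (simp add: falling_prod_split A_def B_def P_def mult_ac)
    also have "1 / (s - of_nat m) = (if e = 0 then 0 else 1 / (s - of_nat m)) + (if e = 0 then 1 else 0) / (s - P)"
      by (simp add: m_def P_def)
    also have "a + b / w - (x + y / w + z / w) = (a - x) + (b - y - z) / w" for a b w x y z :: complex
      by (simp add: diff_divide_distrib)
    finally show ?thesis
      by (simp only: R_def N_def)
  qed
  then have "eventually (\<lambda>s. frac_mellin m s = R s + N s / (s - P)) (at P)"
    unfolding eventually_at by (intro exI[of _ "1 / 2"]) auto
  note lim = removable_pole_limit[OF contF contR N' this]
  have "N P = (if e = 0 then 1 else 0) - c k / fact p - (\<Sum>j<e. d j * riemann_zeta (- of_nat j))"
    unfolding N_def A B d Pk Ppj by (simp add: \<eta>(2) del: fact_Suc)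
  with lim(1) show pole: ?th1 by (simp add: c_def)
  have "?D = - (c k / fact p * euler_mascheroni) + harm p * (c k / fact p + (\<Sum>j<e. d j * riemann_zeta (- of_nat j)))
     - (\<Sum>j<e. d j * (deriv riemann_zeta (- of_nat j) + harm j * riemann_zeta (- of_nat j)))"
    unfolding d by (simp add: algebra_simps sum.distrib sum_subtractf sum_distrib_left diff_divide_distrib)
  also have "c k / fact p + (\<Sum>j<e. d j * riemann_zeta (- of_nat j)) = (if e = 0 then 1 else 0)"
    using pole by (simp add: c_def algebra_simps)
  finally have D: "?D = - (c k / fact p * euler_mascheroni) + harm p * (if e = 0 then 1 else 0)
     - (\<Sum>j<e. d j * (deriv riemann_zeta (- of_nat j) + harm j * riemann_zeta (- of_nat j)))" .
  show ?th2
    using lim(2) unfolding D by (simp add: R_def P_def c_def)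
qed

section \<open>Zeta and its derivative at the nonpositive integers\<close>

text \<open>The residues of \<open>F_{q+1}\<close> at \<open>1\<close> cancel.\<close>

lemma zeta_neg_of_nat_recurrence:
  assumes "q > 0"
  shows "(\<Sum>j<q. of_nat (q choose j) * ((-1) ^ j * riemann_zeta (- of_nat j))) = - 1 / of_nat (Suc q)"
proof -
  let ?d = "\<lambda>j. frac_mellin_coeff (Suc q) (Suc j) * (- 1) ^ j / fact j"
  have "?d j = of_nat (Suc q) * (of_nat (q choose j) * (- 1) ^ j)" if "j < q" for j
    using that by (simp add: frac_mellin_coeff_def binomial_fact mult_ac del: fact_Suc of_nat_Suc) (simp add: mult_ac)
  then have "(\<Sum>j<q. ?d j * riemann_zeta (- of_nat j)) =
      (\<Sum>j<q. of_nat (Suc q) * (of_nat (q choose j) * ((-1) ^ j * riemann_zeta (- of_nat j))))"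
    by (intro sum.cong refl) (simp add: mult.assoc del: of_nat_Suc)
  moreover have "frac_mellin_coeff (Suc q) 0 = 1"
    by (simp add: frac_mellin_coeff_def del: fact_Suc)
  then have "(\<Sum>j<q. ?d j * riemann_zeta (- of_nat j)) = - 1"
    using frac_mellin_at_pole(1)[where k = 0 and e = q] assms
    by (simp add: algebra_simps)
  ultimately have "of_nat (Suc q) * (\<Sum>j<q. of_nat (q choose j) * ((-1) ^ j * riemann_zeta (- of_nat j))) = - 1"
    by (simp only: sum_distrib_left)
  then show ?thesis by (subst eq_divide_eq) (simp add: mult.commute del: of_nat_Suc)
qed

lemma bernoulli_fps_times: "fps_X / (fps_exp 1 - 1) * (fps_exp 1 - 1) = (fps_X :: real fps)"
proof (rule dvd_div_mult_self)
  let ?g = "fps_exp 1 - 1 :: real fps"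
  have "?g \<noteq> 0" by (auto simp: fps_eq_iff intro!: exI[of _ 1])
  moreover have "subdegree ?g \<le> 1" by (rule subdegree_leI) simp
  ultimately show "?g dvd fps_X" by (subst fps_dvd_iff) auto
qed

lemma bernoulli_0: "bernoulli 0 = 1"
proof -
  have "fps_nth (fps_X / (fps_exp 1 - 1) * (fps_exp 1 - 1) :: real fps) 1 = 1"
    unfolding bernoulli_fps_times by simp
  then show ?thesis by (simp add: fps_mult_nth bernoulli_def)
qed

text \<open>Compare coefficients in \<open>(exp t - 1) \<cdot> (t / (exp t - 1)) = t\<close>.\<close>

lemma bernoulli_recurrence:
  assumes "q > 0"
  shows "(\<Sum>i\<le>q. of_nat (Suc q choose i) * bernoulli i) = 0"
proof -
  define f where "f = (fps_X / (fps_exp 1 - 1) :: real fps)"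
  let ?g = "fps_exp 1 - 1 :: real fps"
  have "fps_nth (f * ?g) (Suc q) = 0"
    unfolding f_def bernoulli_fps_times using assms by simp
  then have "(\<Sum>i\<le>Suc q. f $ i * ?g $ (Suc q - i)) = 0" by (simp add: fps_mult_nth atMost_atLeast0)
  then have eq: "(\<Sum>i\<le>q. f $ i * ?g $ (Suc q - i)) = 0" by simp
  have "of_nat (Suc q choose i) * bernoulli i = fact (Suc q) * (f $ i * ?g $ (Suc q - i))" if "i \<le> q" for i
  proof -
    have "?g $ (Suc q - i) = 1 / fact (Suc q - i)" using that by (simp add: Suc_diff_le del: fact_Suc)
    then show ?thesis
      using that by (simp add: bernoulli_def f_def[symmetric] binomial_fact del: fact_Suc)
  qed
  then have "(\<Sum>i\<le>q. of_nat (Suc q choose i) * bernoulli i) = fact (Suc q) * (\<Sum>i\<le>q. f $ i * ?g $ (Suc q - i))"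
    unfolding sum_distrib_left by (intro sum.cong) auto
  then show ?thesis using eq by simp
qed

text \<open>Both \<open>(-1)^j \<zeta>(-j)\<close> and \<open>B_{j+1} / (j + 1)\<close> satisfy the same triangular recurrence, which determines its solution.
At \<open>j = 0\<close> the sign convention \<open>B_1 = - 1 / 2\<close> of the generating function is the right one.\<close>

lemma zeta_neg_of_nat:
  "riemann_zeta (- of_nat j) = (-1) ^ j * of_real (bernoulli (Suc j)) / of_nat (Suc j)"
proof -
  define x where "x = (\<lambda>j. (-1) ^ j * riemann_zeta (- of_nat j))"
  define b where "b = (\<lambda>j. complex_of_real (bernoulli (Suc j) / real (Suc j)))"
  have rec_b: "(\<Sum>j<q. of_nat (q choose j) * b j) = - 1 / of_nat (Suc q)" if "q > 0" for q
  proof -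
    have "(\<Sum>j<q. real (q choose j) * (bernoulli (Suc j) / real (Suc j))) =
        (\<Sum>j<q. real (Suc q choose Suc j) * bernoulli (Suc j)) / real (Suc q)"
      unfolding sum_divide_distrib
    proof (intro sum.cong refl)
      fix j
      have "real (Suc q) * real (q choose j) = real (Suc q choose Suc j) * real (Suc j)"
        using Suc_times_binomial[of j q] by (metis mult.commute of_nat_mult)
      then show "real (q choose j) * (bernoulli (Suc j) / real (Suc j)) =
          real (Suc q choose Suc j) * bernoulli (Suc j) / real (Suc q)"
        by (simp add: divide_simps mult_ac del: of_nat_Suc binomial_Suc_Suc)
    qed
    also have "(\<Sum>j<q. real (Suc q choose Suc j) * bernoulli (Suc j)) = - 1"
      using bernoulli_recurrence[OF that] bernoulli_0
      unfolding lessThan_Suc_atMost[symmetric] sum.lessThan_Suc_shift by simp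
    finally have "complex_of_real (\<Sum>j<q. real (q choose j) * (bernoulli (Suc j) / real (Suc j))) = of_real (- 1 / real (Suc q))"
      by (simp only:)
    then show ?thesis by (simp add: b_def)
  qed
  have "x j = b j"
  proof (induction j rule: less_induct)
    case (less j)
    have "(\<Sum>i<j. of_nat (Suc j choose i) * x i) = (\<Sum>i<j. of_nat (Suc j choose i) * b i)"
      using less by (intro sum.cong) auto
    moreover have "(\<Sum>i<Suc j. of_nat (Suc j choose i) * x i) = (\<Sum>i<Suc j. of_nat (Suc j choose i) * b i)"
      using zeta_neg_of_nat_recurrence[of "Suc j"] rec_b[of "Suc j"] by (simp only: x_def zero_less_Suc)
    ultimately have "of_nat (Suc j choose j) * x j = of_nat (Suc j choose j) * b j"
      by (simp only: sum.lessThan_Suc add_left_cancel)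
    then show ?case by (simp del: of_nat_Suc)
  qed
  then have "(-1) ^ j * x j = (-1) ^ j * b j" by simp
  then show ?thesis by (simp add: x_def b_def power_mult_distrib[symmetric] mult.assoc[symmetric])
qed

text \<open>The trivial zeros come from the sine in the functional equation.\<close>

lemma zeta_neg_even_of_nat:
  assumes "even n" "n > 0"
  shows "riemann_zeta (- of_nat n) = 0"
proof -
  obtain k where k: "n = 2 * k" using assms by auto
  have "of_real pi * - complex_of_nat n / 2 = of_real (- (real k * pi))" by (simp add: k)
  then have "sin (of_real pi * - complex_of_nat n / 2) = of_real (sin (- (real k * pi)))"
    by (simp only: sin_of_real)
  then have "sin (of_real pi * - complex_of_nat n / 2) = 0" by (simp only: sin_minus sin_npi) simp
  then show ?thesis using zeta_functional_equation[of "- of_nat n"] assms by simp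
qed

text \<open>Needed to divide by \<open>\<zeta>(n + 1)\<close>; on the integers \<open>> 1\<close> it follows from positivity of the Dirichlet series.\<close>

lemma riemann_zeta_of_nat_nonzero:
  assumes "n > 1"
  shows "riemann_zeta (of_nat n) \<noteq> 0"
proof -
  have "(\<lambda>k. 1 / of_nat (Suc k) powr (of_nat n)) sums riemann_zeta (of_nat n)"
    by (rule riemann_zeta_sums) (use assms in simp)
  moreover have "1 / of_nat (Suc k) powr complex_of_nat n = of_real (1 / real (Suc k) ^ n)" for k
    by (simp add: powr_nat' del: of_nat_Suc)
  ultimately have sums: "(\<lambda>k. complex_of_real (1 / real (Suc k) ^ n)) sums riemann_zeta (of_nat n)"
    by simp
  then have "(\<lambda>k. Re (complex_of_real (1 / real (Suc k) ^ n))) sums Re (riemann_zeta (of_nat n))"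
    by (rule sums_Re)
  then have "(\<lambda>k. 1 / real (Suc k) ^ n) sums Re (riemann_zeta (of_nat n))" by (simp only: Re_complex_of_real)
  then have "0 < Re (riemann_zeta (of_nat n))"
    by (metis (no_types, lifting) sums_summable sums_unique suminf_pos divide_pos_pos zero_less_one zero_less_power of_nat_0_less_iff zero_less_Suc)
  then show ?thesis by auto
qed

text \<open>The logarithmic derivative of the functional equation at \<open>-n\<close>. For odd \<open>n\<close> the sine is \<open>\<plusminus> 1\<close> there and stationary, so it
contributes nothing; the factor \<open>\<Gamma>(1 - s)\<close> contributes \<open>\<psi>(n + 1) = H_n - \<gamma>\<close>.\<close>

lemma deriv_zeta_neg_odd:
  assumes "odd n"
  shows "deriv riemann_zeta (- of_nat n) = riemann_zeta (- of_nat n) *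
           (of_real (ln (2 * pi)) - (harm n - euler_mascheroni)
             - deriv riemann_zeta (of_nat (Suc n)) / riemann_zeta (of_nat (Suc n)))"
proof -
  define s0 where "s0 = - complex_of_nat n"
  define K where "K = (\<lambda>s. 2 * (of_real (2 * pi)) powr (s - 1) * sin (of_real pi * s / 2) * Gamma (1 - s) * riemann_zeta (1 - s))"
  have n0: "n > 0" using assms by (cases n) auto
  have s1: "1 - s0 = of_nat (Suc n)" by (simp add: s0_def)
  have G: "1 - s0 \<notin> \<int>\<^sub>\<le>\<^sub>0" unfolding s1 by (auto elim!: nonpos_Ints_cases simp: complex_eq_iff simp del: of_nat_Suc)
  have z1: "riemann_zeta (1 - s0) \<noteq> 0" unfolding s1 by (rule riemann_zeta_of_nat_nonzero) (use n0 in auto)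
  have "1 - s0 \<noteq> 1" using n0 by (simp add: s0_def)
  then have z': "(riemann_zeta has_field_derivative deriv riemann_zeta (1 - s0)) (at (1 - s0))"
    by (intro holomorphic_derivI[OF holomorphic_riemann_zeta]) auto
  have cos0: "cos (of_real pi * s0 / 2) = 0"
  proof -
    obtain k where k: "n = 2 * k + 1" using assms by (elim oddE)
    have "of_real pi * s0 / 2 = of_real (- (real k * pi + pi / 2))" by (simp add: k s0_def field_simps)
    then have "cos (of_real pi * s0 / 2) = of_real (cos (real k * pi + pi / 2))" 
      by (simp only: cos_of_real cos_minus)
    also have "cos (real k * pi + pi / 2) = 0" by (simp add: cos_add)
    finally show ?thesis by simp
  qed
  have d1: "((\<lambda>s. of_real (2 * pi) powr (s - 1)) has_field_derivative
      Ln (of_real (2 * pi)) * of_real (2 * pi) powr (s0 - 1) * 1) (at s0)"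
    by (rule DERIV_chain2[where f = "\<lambda>z. of_real (2 * pi) powr z", OF has_field_derivative_powr_right])
       (auto intro!: derivative_eq_intros)
  have d2: "((\<lambda>s. sin (of_real pi * s / 2)) has_field_derivative 0) (at s0)"
    using cos0 by (auto intro!: derivative_eq_intros)
  have d3: "((\<lambda>s. Gamma (1 - s)) has_field_derivative (Gamma (1 - s0) * Digamma (1 - s0)) * (- 1)) (at s0)"
    by (rule DERIV_chain2[where f = Gamma and g = "\<lambda>s. 1 - s", OF has_field_derivative_Gamma[OF G]]) (auto intro!: derivative_eq_intros)
  have d4: "((\<lambda>s. riemann_zeta (1 - s)) has_field_derivative deriv riemann_zeta (1 - s0) * (- 1)) (at s0)"
    by (rule DERIV_chain2[where f = riemann_zeta and g = "\<lambda>s. 1 - s", OF z']) (auto intro!: derivative_eq_intros)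
  (* The left-hand side has the shape in which the product rule delivers the derivative of K. *)
  have log_deriv: "((2 * (l * a * 1) * b + 0 * (2 * a)) * c + c * g * - 1 * (2 * a * b)) * z + w * - 1 * (2 * a * b * c)
      = 2 * a * b * c * z * (l - g - w / z)" if "z \<noteq> 0" for a b c g l w z :: complex
    using that by (simp add: field_simps)
  have "(K has_field_derivative
      K s0 * (Ln (of_real (2 * pi)) - Digamma (1 - s0) - deriv riemann_zeta (1 - s0) / riemann_zeta (1 - s0))) (at s0)"
    unfolding K_def log_deriv[OF z1, symmetric]
    by (rule DERIV_mult[OF DERIV_mult[OF DERIV_mult[OF DERIV_cmult[OF d1, of 2] d2] d3] d4])
  moreover have "eventually (\<lambda>s. s \<in> {s. Re s < 0}) (nhds s0)"
    using open_halfspace_Re_lt[of 0] n0 by (intro eventually_nhds_in_open) (auto simp: s0_def)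
  then have "eventually (\<lambda>s. riemann_zeta s = K s) (nhds s0)"
    by eventually_elim (use zeta_functional_equation in \<open>auto simp: K_def\<close>)
  moreover from eventually_nhds_x_imp_x[OF this] have "riemann_zeta s0 = K s0" .
  ultimately have "(riemann_zeta has_field_derivative
      riemann_zeta s0 * (Ln (of_real (2 * pi)) - Digamma (1 - s0) - deriv riemann_zeta (1 - s0) / riemann_zeta (1 - s0))) (at s0)"
    using DERIV_cong_ev[of s0 s0 riemann_zeta K] by auto
  note deriv_eq = DERIV_imp_deriv[OF this]
  have "Ln (of_real (2 * pi)) = complex_of_real (ln (2 * pi))" by (rule Ln_of_real) simp
  from deriv_eq[unfolded s1 Digamma_of_nat this, unfolded s0_def] show ?thesis .
qed

text \<open>The uniform description behind the two cases of the definition: for even \<open>n\<close> the second summand vanishes (\<open>H_0 = 0\<close>, and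
\<open>-n\<close> is a trivial zero otherwise), for odd \<open>n\<close> the harmonic number cancels the one in \<open>\<zeta>'(-n)\<close>.\<close>

lemma a_seq_eq:
  "a_seq n = (-1) ^ Suc n * (deriv riemann_zeta (- of_nat n) + harm n * riemann_zeta (- of_nat n))"
proof (cases "even n")
  case True
  then have "harm n * riemann_zeta (- of_nat n) = 0"
    using zeta_neg_even_of_nat[of n] by (cases "n = 0") (auto simp: harm_def)
  with True show ?thesis by (simp add: a_seq_def)
next
  case False
  have "riemann_zeta (- of_nat n) = - of_real (bernoulli (n + 1)) / of_nat (n + 1)"
    using False zeta_neg_of_nat[of n] by simp
  then show ?thesis
    using False deriv_zeta_neg_odd[OF False] by (simp add: a_seq_def algebra_simps del: of_nat_Suc)
qed

section \<open>Evaluation of the integrals\<close>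

lemma frac_mellin_coeff_over_falling_prod:
  assumes "i \<le> k"
  shows "frac_mellin_coeff m i / falling_prod (Suc i) (of_nat (Suc k)) =
           fact m * fact (k - i) / ((of_nat k + 1) * fact k * fact (m - i))"
proof -
  have "fact (Suc k) = (of_nat k + 1) * (fact k :: complex)" by (simp add: add.commute)
  then show ?thesis
    using assms falling_prod_of_nat[of "Suc i" "Suc k"]
    by (simp add: frac_mellin_coeff_def mult_ac del: fact_Suc of_nat_Suc)
qed

text \<open>Here \<open>k + 1 > m\<close> is not a pole of the expansion; the summation index is \<open>j = k - i\<close>.\<close>

lemma frac_integral_regular:
  assumes k: "m \<le> k"
  shows "complex_of_real (frac_integral k m) = 1 / (of_nat k + 1 - of_nat m)
      - 1 / ((of_nat k + 1) * of_nat (k choose m)) *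
        (\<Sum>j = k - m + 1..k. of_nat (j choose (k - m)) * riemann_zeta (of_nat (j + 1)))"
proof -
  have "complex_of_nat (Suc k) \<notin> of_nat ` {..m}"
  proof
    assume "complex_of_nat (Suc k) \<in> of_nat ` {..m}"
    then obtain n where "n \<le> m" "complex_of_nat (Suc k) = of_nat n" by blast
    then show False using k by (simp only: of_nat_eq_iff)
  qed
  then have "complex_of_real (frac_integral k m) = 1 / (of_nat (Suc k) - of_nat m) -
      (\<Sum>i<m. frac_mellin_coeff m i / falling_prod (Suc i) (of_nat (Suc k)) * riemann_zeta (of_nat (Suc k) - of_nat i))"
    unfolding frac_integral_eq_frac_mellin by (intro frac_mellin_expansion) auto
  also have "(\<Sum>i<m. frac_mellin_coeff m i / falling_prod (Suc i) (of_nat (Suc k)) * riemann_zeta (of_nat (Suc k) - of_nat i)) =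
      (\<Sum>j = k - m + 1..k. 1 / ((of_nat k + 1) * of_nat (k choose m)) * (of_nat (j choose (k - m)) * riemann_zeta (of_nat (j + 1))))"
  proof (rule sum.reindex_bij_witness[of _ "\<lambda>j. k - j" "\<lambda>i. k - i"])
    fix i assume "i \<in> {..<m}"
    then have i: "i < m" "i \<le> k" using k by auto
    have "frac_mellin_coeff m i / falling_prod (Suc i) (of_nat (Suc k)) =
        1 / ((of_nat k + 1) * of_nat (k choose m)) * of_nat ((k - i) choose (k - m))"
      unfolding frac_mellin_coeff_over_falling_prod[OF i(2)]
      using i k by (simp add: binomial_fact mult_ac)
    moreover have "complex_of_nat (Suc k) - of_nat i = of_nat ((k - i) + 1)"
      using i by (simp add: of_nat_diff)
    ultimately show "1 / ((of_nat k + 1) * of_nat (k choose m)) * (of_nat ((k - i) choose (k - m)) * riemann_zeta (of_nat ((k - i) + 1))) =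
        frac_mellin_coeff m i / falling_prod (Suc i) (of_nat (Suc k)) * riemann_zeta (of_nat (Suc k) - of_nat i)"
      by (simp only: mult.assoc)
  qed (use k in auto)
  finally show "complex_of_real (frac_integral k m) = 1 / (of_nat k + 1 - of_nat m)
      - 1 / ((of_nat k + 1) * of_nat (k choose m)) *
        (\<Sum>j = k - m + 1..k. of_nat (j choose (k - m)) * riemann_zeta (of_nat (j + 1)))"
    by (simp add: sum_distrib_left add.commute)
qed

text \<open>The pole of \<open>1 / (s - m)\<close> cancels the pole of \<open>\<zeta>\<close>, and \<open>H_m - \<gamma>\<close> remains as the constant term.\<close>

lemma frac_integral_diagonal:
  "complex_of_real (frac_integral k (Suc k)) = harm (Suc k) - euler_mascheroni
      - (\<Sum>j = 1..k. riemann_zeta (of_nat (j + 1)) / (of_nat j + 1))"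
proof -
  have "complex_of_real (frac_integral k (Suc k)) = harm (Suc k)
      - (\<Sum>i<k. frac_mellin_coeff (Suc k) i / falling_prod (Suc i) (of_nat (Suc k)) * riemann_zeta (of_nat (Suc k) - of_nat i))
      - euler_mascheroni"
    unfolding frac_integral_eq_frac_mellin using frac_mellin_at_pole(2)[of k 0]
    by (simp add: frac_mellin_coeff_def[of _ k] del: of_nat_Suc fact_Suc)
  also have "(\<Sum>i<k. frac_mellin_coeff (Suc k) i / falling_prod (Suc i) (of_nat (Suc k)) * riemann_zeta (of_nat (Suc k) - of_nat i)) =
      (\<Sum>j = 1..k. riemann_zeta (of_nat (j + 1)) / (of_nat j + 1))"
  proof (rule sum.reindex_bij_witness[of _ "\<lambda>j. k - j" "\<lambda>i. k - i"])
    fix i assume "i \<in> {..<k}"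
    then have i: "i < k" by auto
    have "frac_mellin_coeff (Suc k) i / falling_prod (Suc i) (of_nat (Suc k)) = 1 / (of_nat (k - i) + 1)"
    proof -
      have "fact (Suc k) = (of_nat k + 1) * (fact k :: complex)"
        "fact (Suc k - i) = (of_nat (k - i) + 1) * (fact (k - i) :: complex)"
        using i by (simp_all add: Suc_diff_le add.commute)
      moreover have "of_nat n + 1 \<noteq> (0 :: complex)" for n
        using of_nat_neq_0[of n, where 'a = complex] by (simp add: add.commute)
      ultimately show ?thesis
        using i by (simp add: frac_mellin_coeff_over_falling_prod del: fact_Suc of_nat_Suc)
    qed
    moreover have "complex_of_nat (Suc k) - of_nat i = of_nat ((k - i) + 1)"
      using i by (simp add: of_nat_diff)
    ultimately show "riemann_zeta (of_nat ((k - i) + 1)) / (of_nat (k - i) + 1) =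
        frac_mellin_coeff (Suc k) i / falling_prod (Suc i) (of_nat (Suc k)) * riemann_zeta (of_nat (Suc k) - of_nat i)"
      by (simp only: times_divide_eq_left times_divide_eq_right mult_1)
  qed auto
  finally show ?thesis by simp
qed

text \<open>Now the pole of \<open>\<zeta>\<close> is cancelled by the terms with a vanishing denominator. Their constant terms
\<open>\<zeta>'(-j) + H_j \<zeta>(-j)\<close> are the numbers \<open>a_j\<close> up to sign.\<close>

lemma frac_integral_singular:
  assumes "k + 2 \<le> m"
  shows "complex_of_real (frac_integral k m) = 1 / (of_nat k + 1 - of_nat m)
      - 1 / (of_nat k + 1) * of_nat (m choose k) *
        ((\<Sum>j = 1..k. riemann_zeta (of_nat (j + 1)) / of_nat ((m - k + j) choose j)) + euler_mascheroni)
      + of_nat (m choose (k + 1)) * (\<Sum>j = 0..m - k - 2. of_nat ((m - k - 1) choose j) * a_seq j)"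
proof -
  define e where "e = m - k - 1"
  have e: "e > 0" "m = Suc k + e" "m - k - 1 = e" "m - k = Suc e" using assms by (auto simp: e_def)
  have range: "{0..m - k - 2} = {..<e}" using e by auto
  let ?d = "\<lambda>j. frac_mellin_coeff m (Suc k + j) * (- 1) ^ j / (fact (Suc k) * fact j)"
  let ?L = "\<lambda>j. deriv riemann_zeta (- of_nat j) + harm j * riemann_zeta (- of_nat j)"
  have "complex_of_real (frac_integral k m) = 1 / (of_nat (Suc k) - of_nat m)
      - (\<Sum>i<k. frac_mellin_coeff m i / falling_prod (Suc i) (of_nat (Suc k)) * riemann_zeta (of_nat (Suc k) - of_nat i))
      - frac_mellin_coeff m k / fact (Suc k) * euler_mascheroni
      - (\<Sum>j<e. ?d j * ?L j)"
    unfolding frac_integral_eq_frac_mellin using frac_mellin_at_pole(2)[of k e] e(1)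
    by (simp only: e(2) if_False neq0_conv[symmetric])
  also have "(\<Sum>i<k. frac_mellin_coeff m i / falling_prod (Suc i) (of_nat (Suc k)) * riemann_zeta (of_nat (Suc k) - of_nat i)) =
     (\<Sum>j = 1..k. 1 / (of_nat k + 1) * of_nat (m choose k) * (riemann_zeta (of_nat (j + 1)) / of_nat ((m - k + j) choose j)))"
  proof (rule sum.reindex_bij_witness[of _ "\<lambda>j. k - j" "\<lambda>i. k - i"])
    fix i assume "i \<in> {..<k}"
    then have i: "i < k" by auto
    have "frac_mellin_coeff m i / falling_prod (Suc i) (of_nat (Suc k)) =
        1 / (of_nat k + 1) * of_nat (m choose k) / of_nat ((m - k + (k - i)) choose (k - i))"
    proof -
      have "m - k + (k - i) = m - i" "m - i - (k - i) = m - k" using i e by auto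
      then show ?thesis
        using i assms by (simp add: frac_mellin_coeff_over_falling_prod binomial_fact mult_ac del: of_nat_Suc)
    qed
    moreover have "complex_of_nat (Suc k) - of_nat i = of_nat ((k - i) + 1)"
      using i by (simp add: of_nat_diff)
    ultimately show "1 / (of_nat k + 1) * of_nat (m choose k) * (riemann_zeta (of_nat ((k - i) + 1)) / of_nat ((m - k + (k - i)) choose (k - i))) =
        frac_mellin_coeff m i / falling_prod (Suc i) (of_nat (Suc k)) * riemann_zeta (of_nat (Suc k) - of_nat i)"
      by (simp only: times_divide_eq_left times_divide_eq_right mult_1)
  qed auto
  also have "frac_mellin_coeff m k / fact (Suc k) = 1 / (of_nat k + 1) * of_nat (m choose k)"
    using e(2) by (simp add: frac_mellin_coeff_def binomial_fact add_ac mult_ac)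
  also have "(\<Sum>j<e. ?d j * ?L j) = - (of_nat (m choose (k + 1)) * (\<Sum>j<e. of_nat (e choose j) * a_seq j))"
  proof -
    have "?d j * ?L j = - (of_nat (m choose (k + 1)) * (of_nat (e choose j) * a_seq j))" if "j < e" for j
    proof -
      have "frac_mellin_coeff m (Suc k + j) / (fact (Suc k) * fact j) = of_nat (m choose (k + 1)) * of_nat (e choose j)"
        using that unfolding e(2) by (simp add: frac_mellin_coeff_def binomial_fact mult_ac del: fact_Suc binomial_Suc_Suc)
      then have "?d j = of_nat (m choose (k + 1)) * of_nat (e choose j) * (- 1) ^ j"
        by (simp only: times_divide_eq_left[symmetric])
      then show ?thesis by (simp only: a_seq_eq) simp
    qed
    then show ?thesis by (simp add: sum_distrib_left sum_negf)
  qed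
  finally show "complex_of_real (frac_integral k m) = 1 / (of_nat k + 1 - of_nat m)
      - 1 / (of_nat k + 1) * of_nat (m choose k) *
        ((\<Sum>j = 1..k. riemann_zeta (of_nat (j + 1)) / of_nat ((m - k + j) choose j)) + euler_mascheroni)
      + of_nat (m choose (k + 1)) * (\<Sum>j = 0..m - k - 2. of_nat ((m - k - 1) choose j) * a_seq j)"
    unfolding range e(3) sum_distrib_left[symmetric] by (simp add: algebra_simps)
qed

theorem theorem3:
  fixes m :: nat
  assumes "m \<ge> 1"
  shows "(\<forall>k\<ge>m. complex_of_real (frac_integral k m) =
           1 / (of_nat k + 1 - of_nat m)
           - 1 / ((of_nat k + 1) * of_nat (k choose m)) *
             (\<Sum>j = k - m + 1..k. of_nat (j choose (k - m)) * riemann_zeta (of_nat (j + 1)))) \<and>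
         complex_of_real (frac_integral (m - 1) m) =
           harm m - euler_mascheroni
           - (\<Sum>j = 1..m - 1. riemann_zeta (of_nat (j + 1)) / (of_nat j + 1)) \<and>
         (\<forall>k. k + 2 \<le> m \<longrightarrow> complex_of_real (frac_integral k m) =
           1 / (of_nat k + 1 - of_nat m)
           - 1 / (of_nat k + 1) * of_nat (m choose k) *
             ((\<Sum>j = 1..k. riemann_zeta (of_nat (j + 1)) / of_nat ((m - k + j) choose j))
              + euler_mascheroni)
           + of_nat (m choose (k + 1)) *
             (\<Sum>j = 0..m - k - 2. of_nat ((m - k - 1) choose j) * a_seq j))"
  using assms frac_integral_regular[of m] frac_integral_diagonal[of "m - 1"] frac_integral_singular[of _ m]
  by simp

end
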